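(* Let $1<p<n$ be integers, $\alpha_0,\alpha_1>0$ and $\alpha=\alpha_1/\alpha_0$. The Stiefel manifold $\mathrm{St}_{p,n}=\{Y\in\mathbb{R}^{n\times p}:Y^{\mathsf T}Y=I_p\}$ with the Riemannian metric $$\langle\xi,\eta\rangle_{\mathsf g}=\alpha_0\operatorname{Tr}(\xi^{\mathsf T}\eta)+(\alpha_1-\alpha_0)\operatorname{Tr}(\xi^{\mathsf T}YY^{\mathsf T}\eta),\qquad \xi,\eta\in T_Y\mathrm{St}_{p,n},$$ is an Einstein manifold if and only if $\alpha$ satisfies $$(n-1)\alpha^2-(n-2)\alpha+\frac{p-2}{4}=0.$$ For $p=2$, $\alpha=\frac{n-2}{n-1}$ is the only value of $\alpha>0$ that makes $\mathrm{St}_{2,n}$ an Einstein manifold. If $p>2$, there are two values of $\alpha>0$ making $\mathrm{St}_{p,n}$ an Einstein manifold.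
   Context: A Riemannian manifold is an Einstein manifold if its Ricci curvature tensor is proportional to its metric tensor (by a constant). *)

theory Defs
  imports "HOL-Analysis.Analysis"
begin

section \<open>Smooth maps\<close>

primrec Ck_on :: "nat \<Rightarrow> 'a::euclidean_space set \<Rightarrow> ('a \<Rightarrow> 'b::real_normed_vector) \<Rightarrow> bool" where
  "Ck_on 0 S f \<longleftrightarrow> continuous_on S f"
| "Ck_on (Suc k) S f \<longleftrightarrow>
     (\<forall>x\<in>S. f differentiable (at x)) \<and>
     (\<forall>v. Ck_on k S (\<lambda>x. frechet_derivative f (at x) v))"

text \<open>Intended for open domains only: the derivatives are two-sided.\<close>

definition smooth_on :: "'a::euclidean_space set \<Rightarrow> ('a \<Rightarrow> 'b::real_normed_vector) \<Rightarrow> bool" where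
  "smooth_on S f \<longleftrightarrow> (\<forall>k. Ck_on k S f)"

section \<open>Embedded submanifolds of a Euclidean space\<close>

text \<open>
  \<open>M\<close> is a \<open>d\<close>-dimensional smooth embedded submanifold if it is locally the zero set of a smooth
  map with regular value \<open>0\<close>. The codomain \<open>W\<close> of the defining map has dimension
  \<open>DIM('a) - d\<close>, so it can be taken to be a subspace of the ambient space itself.
\<close>

definition smooth_submanifold :: "nat \<Rightarrow> 'a::euclidean_space set \<Rightarrow> bool" where
  "smooth_submanifold d M \<longleftrightarrow>
     (\<forall>p\<in>M. \<exists>U \<Phi> W. open U \<and> p \<in> U \<and> subspace W \<and> dim W + d = DIM('a) \<and>
        smooth_on U (\<Phi> :: 'a \<Rightarrow> 'a) \<and> \<Phi> ` U \<subseteq> W \<and>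
        M \<inter> U = {x \<in> U. \<Phi> x = 0} \<and>
        (\<forall>x\<in>M \<inter> U. range (frechet_derivative \<Phi> (at x)) = W))"

definition smooth_curve_in ::
    "'a::euclidean_space set \<Rightarrow> 'a \<Rightarrow> 'a \<Rightarrow> (real \<Rightarrow> 'a) \<Rightarrow> bool" where
  "smooth_curve_in M p v \<gamma> \<longleftrightarrow>
     (\<exists>\<epsilon>>0. smooth_on {-\<epsilon><..<\<epsilon>} \<gamma> \<and> \<gamma> ` {-\<epsilon><..<\<epsilon>} \<subseteq> M) \<and>
     \<gamma> 0 = p \<and> (\<gamma> has_vector_derivative v) (at 0)"

definition tangent_space :: "'a::euclidean_space set \<Rightarrow> 'a \<Rightarrow> 'a set" where
  "tangent_space M p = {v. \<exists>\<gamma>. smooth_curve_in M p v \<gamma>}"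

text \<open>
  Functions and vector fields on \<open>M\<close> are total functions on the ambient space; only
  their values on \<open>M\<close> matter.
\<close>

definition smooth_fun :: "'a::euclidean_space set \<Rightarrow> ('a \<Rightarrow> 'b::real_normed_vector) \<Rightarrow> bool" where
  "smooth_fun M f \<longleftrightarrow>
     (\<forall>p\<in>M. \<exists>U F. open U \<and> p \<in> U \<and> smooth_on U F \<and> (\<forall>x\<in>M \<inter> U. F x = f x))"

definition vector_field :: "'a::euclidean_space set \<Rightarrow> ('a \<Rightarrow> 'a) \<Rightarrow> bool" where
  "vector_field M X \<longleftrightarrow> smooth_fun M X \<and> (\<forall>p\<in>M. X p \<in> tangent_space M p)"

text \<open>The derivative of \<open>f\<close> at \<open>p\<close> along the tangent vector \<open>v\<close>, computed along a curve in \<open>M\<close>.\<close>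

definition dir_deriv ::
    "'a::euclidean_space set \<Rightarrow> ('a \<Rightarrow> 'b::real_normed_vector) \<Rightarrow> 'a \<Rightarrow> 'a \<Rightarrow> 'b" where
  "dir_deriv M f p v =
     (THE d. \<exists>\<gamma>. smooth_curve_in M p v \<gamma> \<and> ((f \<circ> \<gamma>) has_vector_derivative d) (at 0))"

text \<open>
  The derivatives below are those of vector-valued functions on \<open>M\<close>; each term separately
  need not be tangent to \<open>M\<close>, but the difference is, and it is the commutator of the two fields.
\<close>

definition lie_bracket ::
    "'a::euclidean_space set \<Rightarrow> ('a \<Rightarrow> 'a) \<Rightarrow> ('a \<Rightarrow> 'a) \<Rightarrow> 'a \<Rightarrow> 'a" where
  "lie_bracket M X Y = (\<lambda>p. dir_deriv M Y p (X p) - dir_deriv M X p (Y p))"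

section \<open>Riemannian metrics, the Levi-Civita connection and curvature\<close>

definition riemannian_metric ::
    "'a::euclidean_space set \<Rightarrow> ('a \<Rightarrow> 'a \<Rightarrow> 'a \<Rightarrow> real) \<Rightarrow> bool" where
  "riemannian_metric M g \<longleftrightarrow>
     (\<forall>p\<in>M. \<forall>u\<in>tangent_space M p. \<forall>v\<in>tangent_space M p. \<forall>w\<in>tangent_space M p. \<forall>c.
        g p (u + v) w = g p u w + g p v w \<and>
        g p (c *\<^sub>R u) w = c * g p u w \<and>
        g p u v = g p v u \<and>
        (u \<noteq> 0 \<longrightarrow> g p u u > 0)) \<and>
     (\<forall>X Y. vector_field M X \<longrightarrow> vector_field M Y \<longrightarrow> smooth_fun M (\<lambda>p. g p (X p) (Y p)))"

definition riemannian_manifold ::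
    "'a::euclidean_space set \<Rightarrow> ('a \<Rightarrow> 'a \<Rightarrow> 'a \<Rightarrow> real) \<Rightarrow> bool" where
  "riemannian_manifold M g \<longleftrightarrow> (\<exists>d. smooth_submanifold d M) \<and> riemannian_metric M g"

type_synonym 'a connection = "('a \<Rightarrow> 'a) \<Rightarrow> ('a \<Rightarrow> 'a) \<Rightarrow> 'a \<Rightarrow> 'a"

definition affine_connection :: "'a::euclidean_space set \<Rightarrow> 'a connection \<Rightarrow> bool" where
  "affine_connection M nabla \<longleftrightarrow>
     (\<forall>X Y. vector_field M X \<longrightarrow> vector_field M Y \<longrightarrow> vector_field M (nabla X Y)) \<and>
     (\<forall>X Y Z. vector_field M X \<longrightarrow> vector_field M Y \<longrightarrow> vector_field M Z \<longrightarrow>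
        (\<forall>p\<in>M. nabla (\<lambda>q. X q + Y q) Z p = nabla X Z p + nabla Y Z p \<and>
                nabla X (\<lambda>q. Y q + Z q) p = nabla X Y p + nabla X Z p)) \<and>
     (\<forall>f X Y. smooth_fun M (f :: 'a \<Rightarrow> real) \<longrightarrow> vector_field M X \<longrightarrow> vector_field M Y \<longrightarrow>
        (\<forall>p\<in>M. nabla (\<lambda>q. f q *\<^sub>R X q) Y p = f p *\<^sub>R nabla X Y p \<and>
                nabla X (\<lambda>q. f q *\<^sub>R Y q) p
                  = dir_deriv M f p (X p) *\<^sub>R Y p + f p *\<^sub>R nabla X Y p))"

definition is_levi_civita ::
    "'a::euclidean_space set \<Rightarrow> ('a \<Rightarrow> 'a \<Rightarrow> 'a \<Rightarrow> real) \<Rightarrow> 'a connection \<Rightarrow> bool" where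
  "is_levi_civita M g nabla \<longleftrightarrow>
     affine_connection M nabla \<and>
     (\<forall>X Y. vector_field M X \<longrightarrow> vector_field M Y \<longrightarrow>
        (\<forall>p\<in>M. nabla X Y p - nabla Y X p = lie_bracket M X Y p)) \<and>
     (\<forall>X Y Z. vector_field M X \<longrightarrow> vector_field M Y \<longrightarrow> vector_field M Z \<longrightarrow>
        (\<forall>p\<in>M. dir_deriv M (\<lambda>q. g q (Y q) (Z q)) p (X p)
                = g p (nabla X Y p) (Z p) + g p (Y p) (nabla X Z p)))"

text \<open>
  On a Riemannian manifold such a connection exists and its values on \<open>M\<close> are unique, so the
  choice is immaterial.
\<close>

definition levi_civita ::
    "'a::euclidean_space set \<Rightarrow> ('a \<Rightarrow> 'a \<Rightarrow> 'a \<Rightarrow> real) \<Rightarrow> 'a connection" where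
  "levi_civita M g = (SOME nabla. is_levi_civita M g nabla)"

definition curvature ::
    "'a::euclidean_space set \<Rightarrow> ('a \<Rightarrow> 'a \<Rightarrow> 'a \<Rightarrow> real) \<Rightarrow>
     ('a \<Rightarrow> 'a) \<Rightarrow> ('a \<Rightarrow> 'a) \<Rightarrow> ('a \<Rightarrow> 'a) \<Rightarrow> 'a \<Rightarrow> 'a" where
  "curvature M g X Y Z = (let nabla = levi_civita M g in
     (\<lambda>p. nabla X (nabla Y Z) p - nabla Y (nabla X Z) p - nabla (lie_bracket M X Y) Z p))"

definition extend_field :: "'a::euclidean_space set \<Rightarrow> 'a \<Rightarrow> 'a \<Rightarrow> 'a \<Rightarrow> 'a" where
  "extend_field M p v = (SOME X. vector_field M X \<and> X p = v)"

text \<open>By tensoriality the value does not depend on the chosen extensions.\<close>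

definition curvature_at ::
    "'a::euclidean_space set \<Rightarrow> ('a \<Rightarrow> 'a \<Rightarrow> 'a \<Rightarrow> real) \<Rightarrow> 'a \<Rightarrow> 'a \<Rightarrow> 'a \<Rightarrow> 'a \<Rightarrow> 'a" where
  "curvature_at M g p u v w =
     curvature M g (extend_field M p u) (extend_field M p v) (extend_field M p w) p"

text \<open>The trace of an endomorphism \<open>L\<close> of the subspace \<open>V\<close>, in an arbitrary basis of \<open>V\<close>.\<close>

definition trace_on :: "'a::euclidean_space set \<Rightarrow> ('a \<Rightarrow> 'a) \<Rightarrow> real" where
  "trace_on V L = (let B = (SOME B. independent B \<and> span B = V) in
     (\<Sum>b\<in>B. representation B (L b) b))"

definition ricci ::
    "'a::euclidean_space set \<Rightarrow> ('a \<Rightarrow> 'a \<Rightarrow> 'a \<Rightarrow> real) \<Rightarrow> 'a \<Rightarrow> 'a \<Rightarrow> 'a \<Rightarrow> real" where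
  "ricci M g p v w = trace_on (tangent_space M p) (\<lambda>u. curvature_at M g p u v w)"

definition einstein_manifold ::
    "'a::euclidean_space set \<Rightarrow> ('a \<Rightarrow> 'a \<Rightarrow> 'a \<Rightarrow> real) \<Rightarrow> bool" where
  "einstein_manifold M g \<longleftrightarrow> riemannian_manifold M g \<and>
     (\<exists>c. \<forall>p\<in>M. \<forall>v\<in>tangent_space M p. \<forall>w\<in>tangent_space M p. ricci M g p v w = c * g p v w)"

section \<open>The Stiefel manifold\<close>

text \<open>Elements of \<open>real^'p^'n\<close> are matrices with \<open>CARD('n)\<close> rows and \<open>CARD('p)\<close> columns.\<close>

definition stiefel :: "(real^'p::finite^'n::finite) set" where
  "stiefel = {Y. transpose Y ** Y = mat 1}"

definition stiefel_metric ::
    "real \<Rightarrow> real \<Rightarrow> real^'p::finite^'n::finite \<Rightarrow> real^'p^'n \<Rightarrow> real^'p^'n \<Rightarrow> real" where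
  "stiefel_metric \<alpha>0 \<alpha>1 Y \<xi> \<eta> =
     \<alpha>0 * trace (transpose \<xi> ** \<eta>) +
     (\<alpha>1 - \<alpha>0) * trace (transpose \<xi> ** Y ** transpose Y ** \<eta>)"

end

theory Submission
  imports Defs
begin

text \<open>
  The Levi-Civita connection on the Stiefel manifold is \<open>\<nabla>\<^sub>X Y = D\<^sub>X Y + \<Gamma> X Y\<close>, where
  \<open>\<Gamma> v w = (1/2) q (v\<^sup>T w + w\<^sup>T v) - (1 - \<alpha>) (1 - q q\<^sup>T) (v q\<^sup>T w + w q\<^sup>T v)\<close>
  is a polynomial in the base point \<open>q\<close>; tangency and metric compatibility are matrix identities, and
  uniqueness is Koszul's argument. As \<open>\<Gamma>\<close> extends to the ambient space, the curvature is
  \<open>R u v w = \<Gamma>' u v w - \<Gamma>' v u w + \<Gamma> u (\<Gamma> v w) - \<Gamma> v (\<Gamma> u w)\<close>, with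
  \<open>\<Gamma>' u\<close> the derivative of \<open>\<Gamma>\<close> in the base point. For
  \<open>v = q A + H\<close> and \<open>w = q B + K\<close> with \<open>A\<close>, \<open>B\<close> skew and \<open>q\<^sup>T H = q\<^sup>T K = 0\<close>, taking
  the trace over \<open>u\<close> separately on the two summands of the tangent space gives
  \<open>Ric v w = (n - 2 - (p - 1) \<alpha>) (H \<bullet> K) + ((p - 2) / 4 + (n - p) \<alpha>\<^sup>2) (A \<bullet> B)\<close>,
  whereas the metric is \<open>\<alpha>\<^sub>0 (H \<bullet> K + \<alpha> (A \<bullet> B))\<close>. Both summands are nonzero because
  \<open>1 < p < n\<close>, so the metric is Einstein iff the second coefficient is \<open>\<alpha>\<close> times the first. The
  discriminant of this quadratic equation is \<open>(n - 2)\<^sup>2 - (n - 1) (p - 2)\<close>, at least \<open>1\<close>.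
\<close>

section \<open>Closure properties of smooth maps\<close>

text \<open>The derivatives in \<open>Ck_on\<close> are two-sided, so values off \<open>S\<close>
  could matter. As \<open>S\<close> is open, \<open>f\<close> and \<open>g\<close> agree near each
  of its points, and hence so do their derivatives.\<close>

lemma Ck_on_cong:
  assumes "open S" "\<And>x. x \<in> S \<Longrightarrow> f x = g x" "Ck_on k S f"
  shows "Ck_on k S g"
  using assms(2,3)
proof (induction k arbitrary: f g)
  case 0
  then show ?case by (simp cong: continuous_on_cong_simp)
next
  case (Suc k)
  have D: "(g has_derivative frechet_derivative f (at x)) (at x)" if "x \<in> S" for x
    using Suc.prems that assms(1)
    by (metis Ck_on.simps(2) frechet_derivative_works has_derivative_transform_within_open)
  have "Ck_on k S (\<lambda>x. frechet_derivative g (at x) v)" for v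
    by (rule Suc.IH[of "\<lambda>x. frechet_derivative f (at x) v"])
      (use Suc.prems D frechet_derivative_at in \<open>fastforce+\<close>)
  then show ?case
    using D by (auto simp: differentiable_def)
qed

text \<open>Trades the chosen \<open>frechet_derivative\<close> for any explicit derivative
  \<open>D\<close>, so that inductions on the order can use the usual differentiation rules.\<close>

lemma Ck_on_SucI:
  assumes "open S" "\<And>x. x \<in> S \<Longrightarrow> (f has_derivative D x) (at x)"
    "\<And>v. Ck_on k S (\<lambda>x. D x v)"
  shows "Ck_on (Suc k) S f"
proof -
  have "Ck_on k S (\<lambda>x. frechet_derivative f (at x) v)" for v
    by (rule Ck_on_cong[OF assms(1) _ assms(3)[of v]])
      (simp flip: frechet_derivative_at[OF assms(2)])
  then show ?thesis
    using assms(2) by (auto simp: differentiable_def)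
qed

lemma Ck_on_SucD:
  assumes "Ck_on (Suc k) S f"
  shows "x \<in> S \<Longrightarrow> (f has_derivative frechet_derivative f (at x)) (at x)"
    "Ck_on k S (\<lambda>x. frechet_derivative f (at x) v)"
  using assms by (auto simp: frechet_derivative_works)

lemma Ck_on_subset: "Ck_on k S f \<Longrightarrow> T \<subseteq> S \<Longrightarrow> Ck_on k T f"
  by (induction k arbitrary: f) (auto intro: continuous_on_subset)

lemma Ck_on_Suc_imp: "Ck_on (Suc k) S f \<Longrightarrow> Ck_on k S f"
proof (induction k arbitrary: f)
  case 0
  then show ?case
    by (meson Ck_on.simps continuous_at_imp_continuous_on differentiable_imp_continuous_within)
next
  case (Suc k)
  show ?case
    using Suc.prems Suc.IH[OF Ck_on_SucD(2)[OF Suc.prems]] Ck_on.simps(2)[of _ S f] by blast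
qed

lemma Ck_on_const: "open S \<Longrightarrow> Ck_on k S (\<lambda>x. c)"
proof (induction k arbitrary: c)
  case (Suc k)
  show ?case by (rule Ck_on_SucI[where D = "\<lambda>x v. 0"]) (use Suc in auto)
qed simp

lemma Ck_on_bounded_linear: "open S \<Longrightarrow> bounded_linear f \<Longrightarrow> Ck_on k S f"
proof (cases k)
  case (Suc k')
  show "open S \<Longrightarrow> bounded_linear f \<Longrightarrow> ?thesis" unfolding Suc
    by (rule Ck_on_SucI[where D = "\<lambda>x. f"])
      (auto intro: bounded_linear_imp_has_derivative Ck_on_const)
qed (auto intro: linear_continuous_on)

lemma Ck_on_linear_compose:
  assumes "open S" "bounded_linear A" "Ck_on k S f"
  shows "Ck_on k S (\<lambda>x. A (f x))"
  using assms(3)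
proof (induction k arbitrary: f)
  case 0
  then show ?case
    using assms(2) by (auto intro: bounded_linear.continuous_on)
next
  case (Suc k)
  show ?case
    by (rule Ck_on_SucI[where D = "\<lambda>x v. A (frechet_derivative f (at x) v)"])
      (auto intro!: assms Suc.IH Ck_on_SucD[OF Suc.prems] bounded_linear.has_derivative[OF assms(2)])
qed

lemma Ck_on_add:
  assumes "open S" "Ck_on k S f" "Ck_on k S g"
  shows "Ck_on k S (\<lambda>x. f x + g x)"
  using assms(2,3)
proof (induction k arbitrary: f g)
  case (Suc k)
  show ?case
    by (rule Ck_on_SucI[where D = "\<lambda>x v. frechet_derivative f (at x) v + frechet_derivative g (at x) v"])
      (auto intro!: assms(1) Suc.IH has_derivative_add Ck_on_SucD[OF Suc.prems(1)] Ck_on_SucD[OF Suc.prems(2)])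
qed (auto intro: continuous_intros)

text \<open>The product rule yields two terms of the same shape with one factor differentiated. The
  other factor loses one order through \<open>Ck_on_Suc_imp\<close>, so the induction hypothesis
  covers both.\<close>

lemma Ck_on_bilinear:
  assumes "open S" "bounded_bilinear B" "Ck_on k S f" "Ck_on k S g"
  shows "Ck_on k S (\<lambda>x. B (f x) (g x))"
  using assms(3,4)
proof (induction k arbitrary: f g)
  case 0
  then show ?case
    using assms(2) by (auto intro: bounded_bilinear.continuous_on)
next
  case (Suc k)
  show ?case
    by (rule Ck_on_SucI[where D = "\<lambda>x v. B (f x) (frechet_derivative g (at x) v) + B (frechet_derivative f (at x) v) (g x)"])
      (auto intro!: assms(1) Ck_on_add Suc.IH bounded_bilinear.FDERIV[OF assms(2)] Ck_on_Suc_imp[OF Suc.prems(1)]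
        Ck_on_Suc_imp[OF Suc.prems(2)] Ck_on_SucD[OF Suc.prems(1)] Ck_on_SucD[OF Suc.prems(2)])
qed

lemma smooth_on_has_derivative:
  "smooth_on S f \<Longrightarrow> x \<in> S \<Longrightarrow> (f has_derivative frechet_derivative f (at x)) (at x)"
  unfolding smooth_on_def using Ck_on_SucD(1) by blast

lemma smooth_on_imp_linear_deriv:
  "smooth_on S f \<Longrightarrow> x \<in> S \<Longrightarrow> linear (frechet_derivative f (at x))"
  using smooth_on_has_derivative has_derivative_bounded_linear bounded_linear.linear by blast

lemma smooth_on_subset: "smooth_on S f \<Longrightarrow> T \<subseteq> S \<Longrightarrow> smooth_on T f"
  unfolding smooth_on_def using Ck_on_subset by blast

lemma smooth_on_cong:
  "open S \<Longrightarrow> (\<And>x. x \<in> S \<Longrightarrow> f x = g x) \<Longrightarrow> smooth_on S f \<Longrightarrow> smooth_on S g"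
  unfolding smooth_on_def by (blast intro: Ck_on_cong)

lemma smooth_on_const: "open S \<Longrightarrow> smooth_on S (\<lambda>x. c)"
  unfolding smooth_on_def using Ck_on_const by blast

lemma smooth_on_bounded_linear: "open S \<Longrightarrow> bounded_linear f \<Longrightarrow> smooth_on S f"
  unfolding smooth_on_def using Ck_on_bounded_linear by blast

lemma smooth_on_ident: "open S \<Longrightarrow> smooth_on S (\<lambda>x. x)"
  by (simp add: smooth_on_bounded_linear bounded_linear_ident)

lemma smooth_on_linear_compose:
  "open S \<Longrightarrow> bounded_linear A \<Longrightarrow> smooth_on S f \<Longrightarrow> smooth_on S (\<lambda>x. A (f x))"
  unfolding smooth_on_def using Ck_on_linear_compose by blast

lemma smooth_on_add: "open S \<Longrightarrow> smooth_on S f \<Longrightarrow> smooth_on S g \<Longrightarrow> smooth_on S (\<lambda>x. f x + g x)"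
  unfolding smooth_on_def using Ck_on_add by blast

lemma smooth_on_scaleR_const: "open S \<Longrightarrow> smooth_on S f \<Longrightarrow> smooth_on S (\<lambda>x. c *\<^sub>R f x)"
  by (rule smooth_on_linear_compose) (auto intro: bounded_linear_intros)

lemma smooth_on_diff: "open S \<Longrightarrow> smooth_on S f \<Longrightarrow> smooth_on S g \<Longrightarrow> smooth_on S (\<lambda>x. f x - g x)"
  using smooth_on_add[of S f "\<lambda>x. (-1) *\<^sub>R g x"] smooth_on_scaleR_const[of S g "-1"] by simp

lemma smooth_on_bilinear:
  "open S \<Longrightarrow> bounded_bilinear B \<Longrightarrow> smooth_on S f \<Longrightarrow> smooth_on S g \<Longrightarrow> smooth_on S (\<lambda>x. B (f x) (g x))"
  unfolding smooth_on_def using Ck_on_bilinear by blast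

lemma smooth_on_sum:
  assumes "open S" "finite I" "\<And>i. i \<in> I \<Longrightarrow> smooth_on S (f i)"
  shows "smooth_on S (\<lambda>x. \<Sum>i\<in>I. f i x)"
  using assms(2,3) by (induction I rule: finite_induct) (auto intro: smooth_on_const smooth_on_add assms(1))

lemma smooth_on_frechet_derivative_const:
  "smooth_on S f \<Longrightarrow> smooth_on S (\<lambda>x. frechet_derivative f (at x) v)"
  unfolding smooth_on_def using Ck_on_SucD(2) by blast

text \<open>The direction \<open>X x\<close> varies with the point. Its expansion in the standard
  basis leaves a finite sum of coordinates of \<open>X\<close> times derivatives in fixed
  directions, to which the product rules apply.\<close>

lemma
  assumes "open S" "smooth_on S f" "smooth_on S X"
  shows smooth_on_frechet_derivative: "smooth_on S (\<lambda>x. frechet_derivative f (at x) (X x))"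
    and has_derivative_frechet_derivative: "y \<in> S \<Longrightarrow>
      ((\<lambda>x. frechet_derivative f (at x) (X x)) has_derivative
       (\<lambda>u. frechet_derivative (\<lambda>x. frechet_derivative f (at x) (X y)) (at y) u
          + frechet_derivative f (at y) (frechet_derivative X (at y) u))) (at y)"
proof -
  let ?g = "\<lambda>x. \<Sum>e\<in>Basis. (X x \<bullet> e) *\<^sub>R frechet_derivative f (at x) e"
  have lin: "linear (frechet_derivative f (at x))" if "x \<in> S" for x
    using smooth_on_imp_linear_deriv assms(2) that .
  have expand: "frechet_derivative f (at x) v = (\<Sum>e\<in>Basis. (v \<bullet> e) *\<^sub>R frechet_derivative f (at x) e)"
    if "x \<in> S" for x v
    using lin[OF that] by (subst euclidean_representation[of v, symmetric])
      (simp add: linear_sum linear_cmul)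
  have "smooth_on S ?g"
    by (intro smooth_on_sum smooth_on_bilinear[OF _ bounded_bilinear_scaleR] smooth_on_bilinear[OF _ bounded_bilinear_inner]
        smooth_on_const smooth_on_frechet_derivative_const assms) auto
  then show "smooth_on S (\<lambda>x. frechet_derivative f (at x) (X x))"
    by (rule smooth_on_cong[OF assms(1), rotated]) (simp flip: expand)
  assume that: "y \<in> S"
  have D2: "((\<lambda>x. frechet_derivative f (at x) v) has_derivative
      frechet_derivative (\<lambda>x. frechet_derivative f (at x) v) (at y)) (at y)" for v
    using smooth_on_has_derivative[OF smooth_on_frechet_derivative_const[OF assms(2)] that] .
  have DX: "(X has_derivative frechet_derivative X (at y)) (at y)"
    using smooth_on_has_derivative assms(3) that .
  let ?E = "\<lambda>v. \<lambda>x. frechet_derivative f (at x) v"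
  \<comment> \<open>Linearity of the second derivative in the direction frozen first; it folds the
    differentiated sum back into one term.\<close>
  have D2e: "frechet_derivative (?E v) (at y) u = (\<Sum>e\<in>Basis. (v \<bullet> e) *\<^sub>R frechet_derivative (?E e) (at y) u)" for v u
  proof -
    have "((\<lambda>x. \<Sum>e\<in>Basis. (v \<bullet> e) *\<^sub>R ?E e x) has_derivative
        (\<lambda>u. \<Sum>e\<in>Basis. (v \<bullet> e) *\<^sub>R frechet_derivative (?E e) (at y) u)) (at y)"
      by (intro has_derivative_sum has_derivative_scaleR_right D2)
    then have "(?E v has_derivative (\<lambda>u. \<Sum>e\<in>Basis. (v \<bullet> e) *\<^sub>R frechet_derivative (?E e) (at y) u)) (at y)"
      by (rule has_derivative_transform_within_open[OF _ assms(1) that]) (simp flip: expand)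
    from frechet_derivative_at[OF this] show ?thesis by (rule fun_cong[OF sym])
  qed
  have "(?g has_derivative (\<lambda>u. \<Sum>e\<in>Basis. (X y \<bullet> e) *\<^sub>R frechet_derivative (?E e) (at y) u
       + (frechet_derivative X (at y) u \<bullet> e) *\<^sub>R ?E e y)) (at y)"
    by (intro has_derivative_sum has_derivative_scaleR has_derivative_inner_left D2 DX)
  then have "(?g has_derivative (\<lambda>u. frechet_derivative (?E (X y)) (at y) u
          + frechet_derivative f (at y) (frechet_derivative X (at y) u))) (at y)"
    by (simp add: sum.distrib D2e[of "X y"] flip: expand[OF that])
  then show "((\<lambda>x. frechet_derivative f (at x) (X x)) has_derivative
       (\<lambda>u. frechet_derivative (?E (X y)) (at y) u
          + frechet_derivative f (at y) (frechet_derivative X (at y) u))) (at y)"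
    by (rule has_derivative_transform_within_open[OF _ assms(1) that]) (simp flip: expand)
qed

text \<open>Each function is the derivative of the other up to a constant factor, so one induction
  has to carry both.\<close>

lemma smooth_on_sin_cos:
  "smooth_on UNIV (\<lambda>t::real. sin (c * t))" "smooth_on UNIV (\<lambda>t::real. cos (c * t))"
proof -
  have "Ck_on k UNIV (\<lambda>t::real. sin (c * t)) \<and> Ck_on k UNIV (\<lambda>t::real. cos (c * t))" for k
  proof (induction k)
    case 0
    then show ?case by (auto intro!: continuous_intros)
  next
    case (Suc k)
    have lin: "bounded_linear (\<lambda>x. x * (c * v))" "bounded_linear (\<lambda>x. - (x * (c * v)))" for v :: real
      by (rule bounded_linear_mult_left bounded_linear_minus[OF bounded_linear_mult_left])+
    have "Ck_on (Suc k) UNIV (\<lambda>t. sin (c * t))"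
      by (rule Ck_on_SucI[where D = "\<lambda>t v. cos (c * t) * (c * v)"])
        (auto intro!: Ck_on_linear_compose[OF _ lin(1)] Suc[THEN conjunct2] derivative_eq_intros)
    moreover have "Ck_on (Suc k) UNIV (\<lambda>t. cos (c * t))"
      by (rule Ck_on_SucI[where D = "\<lambda>t v. - (sin (c * t) * (c * v))"])
        (auto intro!: Ck_on_linear_compose[OF _ lin(2)] Suc[THEN conjunct1] derivative_eq_intros)
    ultimately show ?case ..
  qed
  then show "smooth_on UNIV (\<lambda>t::real. sin (c * t))" "smooth_on UNIV (\<lambda>t::real. cos (c * t))"
    by (auto simp: smooth_on_def)
qed

section \<open>Symmetry of the second derivative\<close>

text \<open>The mean value theorem along \<open>u\<close> turns the second difference into
  \<open>t\<close> times a difference of \<open>h\<close>, the derivative of \<open>f\<close> along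
  \<open>u\<close>, at two points that differ by \<open>t\<close> times \<open>v\<close>.
  Differentiability of \<open>h\<close> at the single point \<open>p\<close> evaluates this up to an
  error small against \<open>t\<close>.\<close>

lemma second_difference_quotient:
  fixes f :: "'a::euclidean_space \<Rightarrow> real"
  assumes "open S" "p \<in> S" and df: "\<And>x. x \<in> S \<Longrightarrow> f differentiable (at x)"
    and L: "((\<lambda>q. frechet_derivative f (at q) u) has_derivative L) (at p)"
  shows "((\<lambda>t. (f (p + t *\<^sub>R u + t *\<^sub>R v) - f (p + t *\<^sub>R u) - f (p + t *\<^sub>R v) + f p) / t\<^sup>2)
    \<longlongrightarrow> L v) (at_right 0)"
proof (rule tendstoI)
  fix e :: real assume "e > 0"
  define h where "h = (\<lambda>q. frechet_derivative f (at q) u)"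
  define N where "N = norm u + norm v + 1"
  have "N > 0" unfolding N_def by (simp add: add_nonneg_pos)
  have linL: "linear L" using L has_derivative_linear by blast
  obtain r where r: "r > 0" "ball p r \<subseteq> S" using assms(1,2) open_contains_ball by blast
  \<comment> \<open>Two errors of at most \<open>e' * (t * N)\<close> will occur; together they are
    \<open>t * e / 2\<close>.\<close>
  define e' where "e' = e / (4 * N)"
  have "e' > 0" using \<open>e > 0\<close> \<open>N > 0\<close> by (simp add: e'_def)
  then obtain d where d: "d > 0" "\<And>y. norm (y - p) < d \<Longrightarrow> norm (h y - h p - L (y - p)) \<le> e' * norm (y - p)"
    using L[folded h_def] unfolding has_derivative_at_alt by blast
  define \<delta> where "\<delta> = min r d / N"
  have "\<delta> > 0" using r d \<open>N > 0\<close> by (simp add: \<delta>_def)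
  have main: "dist ((f (p + t *\<^sub>R u + t *\<^sub>R v) - f (p + t *\<^sub>R u) - f (p + t *\<^sub>R v) + f p) / t\<^sup>2) (L v) < e"
    if t: "0 < t" "t < \<delta>" for t
  proof -
    have bound: "norm (s *\<^sub>R u + s' *\<^sub>R v) \<le> t * N" if "0 \<le> s" "s \<le> t" "0 \<le> s'" "s' \<le> t" for s s'
    proof -
      have "norm (s *\<^sub>R u + s' *\<^sub>R v) \<le> s * norm u + s' * norm v"
        using that norm_triangle_ineq[of "s *\<^sub>R u" "s' *\<^sub>R v"] by simp
      also have "\<dots> \<le> t * norm u + t * norm v" using that by (intro add_mono mult_right_mono) auto
      also have "\<dots> \<le> t * N" using t by (simp add: N_def algebra_simps)
      finally show ?thesis .
    qed
    have tN: "t * N < min r d" using t \<open>N > 0\<close> by (simp add: \<delta>_def field_simps)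
    have inS: "p + s *\<^sub>R u + s' *\<^sub>R v \<in> S" if "0 \<le> s" "s \<le> t" "0 \<le> s'" "s' \<le> t" for s s'
      using bound[OF that] tN r(2) by (auto simp: dist_norm subset_iff norm_minus_commute add.assoc algebra_simps)
    define \<phi> where "\<phi> = (\<lambda>s. f (p + s *\<^sub>R u + t *\<^sub>R v) - f (p + s *\<^sub>R u))"
    have deriv: "((\<lambda>s. f (p + s *\<^sub>R u + c *\<^sub>R v)) has_field_derivative h (p + s *\<^sub>R u + c *\<^sub>R v)) (at s)"
      if "0 \<le> s" "s \<le> t" "0 \<le> c" "c \<le> t" for s c
    proof -
      have "((\<lambda>s. p + s *\<^sub>R u + c *\<^sub>R v) has_derivative (\<lambda>r. r *\<^sub>R u)) (at s)"
        by (auto intro!: derivative_eq_intros)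
      moreover have fd: "(f has_derivative frechet_derivative f (at (p + s *\<^sub>R u + c *\<^sub>R v))) (at (p + s *\<^sub>R u + c *\<^sub>R v))"
        using df[OF inS[OF that]] by (simp add: frechet_derivative_works)
      ultimately have "((\<lambda>s. f (p + s *\<^sub>R u + c *\<^sub>R v)) has_derivative
          (\<lambda>r. frechet_derivative f (at (p + s *\<^sub>R u + c *\<^sub>R v)) (r *\<^sub>R u))) (at s)"
        by (rule has_derivative_compose)
      moreover have "frechet_derivative f (at (p + s *\<^sub>R u + c *\<^sub>R v)) (r *\<^sub>R u) = h (p + s *\<^sub>R u + c *\<^sub>R v) * r" for r
        using linear_cmul[OF has_derivative_linear[OF fd], of r u] by (simp add: h_def)
      ultimately show ?thesis by (simp add: has_field_derivative_def)
    qed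
    have "\<exists>z. 0 < z \<and> z < t \<and> \<phi> t - \<phi> 0 = (t - 0) * (h (p + z *\<^sub>R u + t *\<^sub>R v) - h (p + z *\<^sub>R u))"
    proof (rule MVT2)
      fix s assume "0 \<le> s" "s \<le> t"
      then show "DERIV \<phi> s :> h (p + s *\<^sub>R u + t *\<^sub>R v) - h (p + s *\<^sub>R u)"
        unfolding \<phi>_def using deriv[of s t] deriv[of s 0] t by (auto intro: DERIV_diff)
    qed (use t in auto)
    then obtain z where z: "0 < z" "z < t" and \<phi>: "\<phi> t - \<phi> 0 = t * (h (p + z *\<^sub>R u + t *\<^sub>R v) - h (p + z *\<^sub>R u))"
      by auto
    have est: "\<bar>h (p + z *\<^sub>R u + c *\<^sub>R v) - h p - L (z *\<^sub>R u + c *\<^sub>R v)\<bar> \<le> e' * (t * N)"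
      if "0 \<le> c" "c \<le> t" for c
    proof -
      have b: "norm (z *\<^sub>R u + c *\<^sub>R v) \<le> t * N" using bound z that by auto
      moreover have "\<bar>h (p + z *\<^sub>R u + c *\<^sub>R v) - h p - L (z *\<^sub>R u + c *\<^sub>R v)\<bar> \<le> e' * norm (z *\<^sub>R u + c *\<^sub>R v)"
        using d(2)[of "p + z *\<^sub>R u + c *\<^sub>R v"] b tN by (simp add: add.assoc)
      ultimately show ?thesis
        using \<open>e' > 0\<close> by (meson mult_left_mono order_trans less_imp_le)
    qed
    have "L (z *\<^sub>R u + t *\<^sub>R v) - L (z *\<^sub>R u + 0 *\<^sub>R v) = t * L v"
      using linL by (simp add: linear_add linear_cmul)
    then have "\<bar>(h (p + z *\<^sub>R u + t *\<^sub>R v) - h (p + z *\<^sub>R u)) - t * L v\<bar> \<le> 2 * (e' * (t * N))"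
      using est[of t] est[of 0] t by simp
    also have "\<dots> < t * e"
      using t \<open>e > 0\<close> \<open>N > 0\<close> by (simp add: e'_def field_simps)
    finally have lt: "\<bar>(h (p + z *\<^sub>R u + t *\<^sub>R v) - h (p + z *\<^sub>R u)) / t - L v\<bar> < e"
      using t by (simp add: abs_less_iff field_simps)
    have "(f (p + t *\<^sub>R u + t *\<^sub>R v) - f (p + t *\<^sub>R u) - f (p + t *\<^sub>R v) + f p) / t\<^sup>2
        = (\<phi> t - \<phi> 0) / t\<^sup>2"
      by (simp add: \<phi>_def)
    also have "\<dots> = (h (p + z *\<^sub>R u + t *\<^sub>R v) - h (p + z *\<^sub>R u)) / t"
      unfolding \<phi> using t by (simp add: power2_eq_square)
    finally show ?thesis using lt by (simp add: dist_real_def)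
  qed
  show "\<forall>\<^sub>F t in at_right 0. dist ((f (p + t *\<^sub>R u + t *\<^sub>R v) - f (p + t *\<^sub>R u) - f (p + t *\<^sub>R v) + f p) / t\<^sup>2) (L v) < e"
    unfolding eventually_at_right_field using main \<open>\<delta> > 0\<close> by blast
qed

text \<open>The second difference does not change when \<open>u\<close> and \<open>v\<close> are
  exchanged, so both iterated derivatives are limits of the same quotient. Pairing with a basis
  vector \<open>b\<close> makes the function real-valued, as the mean value theorem
  requires.\<close>

lemma second_derivative_symmetric:
  fixes f :: "'a::euclidean_space \<Rightarrow> 'b::euclidean_space"
  assumes "open S" "p \<in> S" "smooth_on S f"
  shows "frechet_derivative (\<lambda>x. frechet_derivative f (at x) u) (at p) v
       = frechet_derivative (\<lambda>x. frechet_derivative f (at x) v) (at p) u"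
proof (rule euclidean_eqI)
  fix b :: 'b
  define F where "F = (\<lambda>x. f x \<bullet> b)"
  have DF: "(F has_derivative (\<lambda>v. frechet_derivative f (at x) v \<bullet> b)) (at x)" if "x \<in> S" for x
    unfolding F_def by (intro has_derivative_inner_left smooth_on_has_derivative[OF assms(3) that])
  have L: "((\<lambda>q. frechet_derivative F (at q) w) has_derivative
      (\<lambda>v. frechet_derivative (\<lambda>x. frechet_derivative f (at x) w) (at p) v \<bullet> b)) (at p)" for w
  proof -
    have "((\<lambda>q. frechet_derivative f (at q) w \<bullet> b) has_derivative
      (\<lambda>v. frechet_derivative (\<lambda>x. frechet_derivative f (at x) w) (at p) v \<bullet> b)) (at p)"
      by (intro has_derivative_inner_left smooth_on_has_derivative[OF _ assms(2)]
          smooth_on_frechet_derivative_const assms(3))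
    then show ?thesis
      by (rule has_derivative_transform_within_open[OF _ assms(1,2)])
        (simp flip: frechet_derivative_at[OF DF])
  qed
  have dF: "F differentiable (at x)" if "x \<in> S" for x
    using DF[OF that] by (auto simp: differentiable_def)
  note q = second_difference_quotient[OF assms(1,2) dF L]
  have sym: "(\<lambda>t. (F (p + t *\<^sub>R v + t *\<^sub>R u) - F (p + t *\<^sub>R v) - F (p + t *\<^sub>R u) + F p) / t\<^sup>2)
    = (\<lambda>t. (F (p + t *\<^sub>R u + t *\<^sub>R v) - F (p + t *\<^sub>R u) - F (p + t *\<^sub>R v) + F p) / t\<^sup>2)"
    by (simp add: add_ac algebra_simps)
  show "frechet_derivative (\<lambda>x. frechet_derivative f (at x) u) (at p) v \<bullet> b
       = frechet_derivative (\<lambda>x. frechet_derivative f (at x) v) (at p) u \<bullet> b"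
    using tendsto_unique[OF _ q[of u v] q[of v u, unfolded sym]] by simp
qed

section \<open>Derivatives along a submanifold\<close>

definition local_ext :: "'a::euclidean_space set \<Rightarrow> 'a set \<Rightarrow> ('a \<Rightarrow> 'b::real_normed_vector) \<Rightarrow> ('a \<Rightarrow> 'b) \<Rightarrow> bool" where
  "local_ext M U f F \<longleftrightarrow> open U \<and> smooth_on U F \<and> (\<forall>x\<in>M \<inter> U. F x = f x)"

lemma smooth_fun_local_ext: "smooth_fun M f \<longleftrightarrow> (\<forall>p\<in>M. \<exists>U F. p \<in> U \<and> local_ext M U f F)"
  unfolding smooth_fun_def local_ext_def by blast

lemma local_ext_subset: "local_ext M U f F \<Longrightarrow> open V \<Longrightarrow> V \<subseteq> U \<Longrightarrow> local_ext M V f F"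
  unfolding local_ext_def using smooth_on_subset by blast

lemma smooth_fun_if_smooth_on: "smooth_on UNIV f \<Longrightarrow> smooth_fun M f"
  unfolding smooth_fun_def by blast

lemma smooth_fun_cong: "(\<And>x. x \<in> M \<Longrightarrow> f x = g x) \<Longrightarrow> smooth_fun M f \<longleftrightarrow> smooth_fun M g"
  unfolding smooth_fun_def by simp

lemma vector_field_cong: "(\<And>x. x \<in> M \<Longrightarrow> X x = Y x) \<Longrightarrow> vector_field M X \<longleftrightarrow> vector_field M Y"
  unfolding vector_field_def using smooth_fun_cong[of M X Y] by simp

lemma smooth_curve_in_eventually:
  assumes "smooth_curve_in M p v \<gamma>"
  shows "eventually (\<lambda>t. \<gamma> t \<in> M) (at 0)"
proof -
  obtain e where e: "e > 0" "\<gamma> ` {-e<..<e} \<subseteq> M"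
    using assms unfolding smooth_curve_in_def by blast
  have "eventually (\<lambda>t. t \<in> {-e<..<e}) (at 0)"
    by (rule eventually_at_in_open') (use e in auto)
  then show ?thesis by (rule eventually_mono) (use e in blast)
qed

lemma smooth_curve_in_base: "smooth_curve_in M p v \<gamma> \<Longrightarrow> p \<in> M"
  unfolding smooth_curve_in_def by force

text \<open>Near parameter 0 the curve stays in \<open>M\<close> by definition and in
  \<open>U\<close> by continuity, so \<open>f\<close> and \<open>F\<close> agree along it and the
  chain rule for \<open>F\<close> applies.\<close>

lemma has_vector_derivative_local_ext:
  assumes F: "local_ext M U f F" "p \<in> U" and \<gamma>: "smooth_curve_in M p v \<gamma>"
  shows "((f \<circ> \<gamma>) has_vector_derivative frechet_derivative F (at p) v) (at 0)"
proof -
  have U: "open U" and FS: "smooth_on U F" and eq: "\<And>x. x \<in> M \<Longrightarrow> x \<in> U \<Longrightarrow> F x = f x"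
    using F unfolding local_ext_def by auto
  have D\<gamma>: "(\<gamma> has_vector_derivative v) (at 0)" and \<gamma>0: "\<gamma> 0 = p" and "p \<in> M"
    using \<gamma> smooth_curve_in_base unfolding smooth_curve_in_def by auto
  have DF: "(F has_derivative frechet_derivative F (at p)) (at p)"
    using smooth_on_has_derivative FS F(2) by blast
  have "((F \<circ> \<gamma>) has_derivative (\<lambda>t. frechet_derivative F (at p) (t *\<^sub>R v))) (at 0)"
    unfolding o_def
    by (rule has_derivative_compose[of \<gamma>]) (use D\<gamma> DF \<gamma>0 in \<open>auto simp: has_vector_derivative_def\<close>)
  then have "((F \<circ> \<gamma>) has_vector_derivative frechet_derivative F (at p) v) (at 0)"
    using linear_cmul[OF has_derivative_linear[OF DF]] by (simp add: has_vector_derivative_def)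
  moreover have "eventually (\<lambda>t. \<gamma> t \<in> U) (at 0)"
    using has_vector_derivative_continuous[OF D\<gamma>] U F(2) \<gamma>0
    by (metis continuous_at topological_tendstoD isCont_def)
  then have "eventually (\<lambda>t. (F \<circ> \<gamma>) t = (f \<circ> \<gamma>) t) (at 0)"
    using smooth_curve_in_eventually[OF \<gamma>] by eventually_elim (simp add: eq)
  moreover have "(F \<circ> \<gamma>) 0 = (f \<circ> \<gamma>) 0"
    using \<gamma>0 F(2) \<open>p \<in> M\<close> eq by simp
  ultimately show ?thesis
    unfolding has_vector_derivative_def
    using has_derivative_transform_eventually[of "F \<circ> \<gamma>" _ 0 UNIV "f \<circ> \<gamma>"] by simp
qed

text \<open>All curves through \<open>p\<close> with velocity \<open>v\<close> produce the same
  derivative, and tangency of \<open>v\<close> supplies such a curve; hence the definite description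
  in \<open>dir_deriv\<close> is well defined.\<close>

lemma dir_deriv_eq:
  assumes "local_ext M U f F" "p \<in> U" "v \<in> tangent_space M p"
  shows "dir_deriv M f p v = frechet_derivative F (at p) v"
  unfolding dir_deriv_def
proof (rule the_equality)
  show "\<exists>\<gamma>. smooth_curve_in M p v \<gamma> \<and> ((f \<circ> \<gamma>) has_vector_derivative frechet_derivative F (at p) v) (at 0)"
    using assms has_vector_derivative_local_ext unfolding tangent_space_def by blast
  show "d = frechet_derivative F (at p) v"
    if "\<exists>\<gamma>. smooth_curve_in M p v \<gamma> \<and> ((f \<circ> \<gamma>) has_vector_derivative d) (at 0)" for d
    using that has_vector_derivative_local_ext[OF assms(1,2)] vector_derivative_unique_at by blast
qed

lemma vector_field_local_ext:
  "vector_field M X \<Longrightarrow> p \<in> M \<Longrightarrow> \<exists>U F. p \<in> U \<and> local_ext M U X F"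
  unfolding vector_field_def smooth_fun_local_ext by blast

lemma vector_field_tangent: "vector_field M X \<Longrightarrow> p \<in> M \<Longrightarrow> X p \<in> tangent_space M p"
  unfolding vector_field_def by blast

lemma common_ext:
  assumes "\<exists>U F. p \<in> U \<and> local_ext M U X F" "\<exists>U F. p \<in> U \<and> local_ext M U Y F"
  obtains U X' Y' where "p \<in> U" "open U" "local_ext M U X X'" "local_ext M U Y Y'"
proof -
  obtain U F V H where *: "p \<in> U" "local_ext M U X F" "p \<in> V" "local_ext M V Y H"
    using assms by blast
  then have "open (U \<inter> V)" unfolding local_ext_def by auto
  then show thesis
    using that[of "U \<inter> V" F H] * local_ext_subset[of M] by (metis IntI inf_le1 inf_le2)
qed

section \<open>The Levi-Civita connection\<close>

lemma
  assumes "riemannian_metric M g" "p \<in> M"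
    and "u \<in> tangent_space M p" "v \<in> tangent_space M p" "w \<in> tangent_space M p"
  shows riemannian_metric_add: "g p (u + v) w = g p u w + g p v w"
    and riemannian_metric_scale: "g p (c *\<^sub>R u) w = c * g p u w"
    and riemannian_metric_sym: "g p u v = g p v u"
    and riemannian_metric_pos: "u \<noteq> 0 \<Longrightarrow> g p u u > 0"
  using assms(1)[unfolded riemannian_metric_def, THEN conjunct1] assms(2-) by auto

lemma is_levi_civita_vector_field:
  "is_levi_civita M g nabla \<Longrightarrow> vector_field M X \<Longrightarrow> vector_field M Y \<Longrightarrow> vector_field M (nabla X Y)"
  unfolding is_levi_civita_def affine_connection_def by (drule conjunct1, drule conjunct1) simp

lemma is_levi_civita_torsion:
  "is_levi_civita M g nabla \<Longrightarrow> vector_field M X \<Longrightarrow> vector_field M Y \<Longrightarrow> p \<in> M \<Longrightarrow>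
    nabla X Y p - nabla Y X p = lie_bracket M X Y p"
  unfolding is_levi_civita_def by blast

lemma is_levi_civita_compatible:
  "is_levi_civita M g nabla \<Longrightarrow> vector_field M X \<Longrightarrow> vector_field M Y \<Longrightarrow> vector_field M Z \<Longrightarrow> p \<in> M \<Longrightarrow>
    dir_deriv M (\<lambda>q. g q (Y q) (Z q)) p (X p) = g p (nabla X Y p) (Z p) + g p (Y p) (nabla X Z p)"
  unfolding is_levi_civita_def by blast

text \<open>The difference \<open>D\<close> of the connections is symmetric because both are
  torsion-free, and skew for \<open>g\<close> because both are compatible with the metric. Applying
  the two rules alternately, three times each, turns \<open>g p (D X Y) (Z p)\<close> into its own
  negative.\<close>

lemma is_levi_civita_unique:
  assumes lc: "is_levi_civita M g nabla" "is_levi_civita M g nabla'"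
    and g: "riemannian_metric M g"
    and sub: "\<And>p. p \<in> M \<Longrightarrow> subspace (tangent_space M p)"
    and ext: "\<And>p v. p \<in> M \<Longrightarrow> v \<in> tangent_space M p \<Longrightarrow> \<exists>X. vector_field M X \<and> X p = v"
    and X: "vector_field M X" and Y: "vector_field M Y" and p: "p \<in> M"
  shows "nabla X Y p = nabla' X Y p"
proof -
  let ?T = "tangent_space M p"
  define D where "D = (\<lambda>X Y. nabla X Y p - nabla' X Y p)"
  have tan: "nabla X Y p \<in> ?T" "nabla' X Y p \<in> ?T" if "vector_field M X" "vector_field M Y" for X Y
    using lc[THEN is_levi_civita_vector_field] that p vector_field_tangent by blast+
  have sym: "D X Y = D Y X" if "vector_field M X" "vector_field M Y" for X Y
  proof -
    have "nabla X Y p - nabla Y X p = nabla' X Y p - nabla' Y X p"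
      using lc[THEN is_levi_civita_torsion] that p by simp
    then show ?thesis by (simp add: D_def algebra_simps)
  qed
  have gsym: "g p u v = g p v u" if "u \<in> ?T" "v \<in> ?T" for u v
    using riemannian_metric_sym[OF g p that that(1)] .
  have gdiff: "g p (u - v) w = g p u w - g p v w" if "u \<in> ?T" "v \<in> ?T" "w \<in> ?T" for u v w
  proof -
    have "g p (u + (-1) *\<^sub>R v) w = g p u w + g p ((-1) *\<^sub>R v) w"
      by (rule riemannian_metric_add[OF g p]) (use that subspace_scale[OF sub[OF p], of v "-1"] in auto)
    moreover have "g p ((-1) *\<^sub>R v) w = (-1) * g p v w"
      by (rule riemannian_metric_scale[OF g p that(2) that(2) that(3)])
    ultimately show ?thesis by simp
  qed
  have skew: "g p (D X Y) (Z p) + g p (Y p) (D X Z) = 0"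
    if "vector_field M X" "vector_field M Y" "vector_field M Z" for X Y Z
  proof -
    have eq: "g p (nabla X Y p) (Z p) + g p (Y p) (nabla X Z p)
      = g p (nabla' X Y p) (Z p) + g p (Y p) (nabla' X Z p)"
      using lc[THEN is_levi_civita_compatible] that p by simp
    have "Y p \<in> ?T" "Z p \<in> ?T" using that p vector_field_tangent by blast+
    then have "g p (D X Y) (Z p) = g p (nabla X Y p) (Z p) - g p (nabla' X Y p) (Z p)"
      "g p (Y p) (D X Z) = g p (Y p) (nabla X Z p) - g p (Y p) (nabla' X Z p)"
      using tan that gdiff gsym[of "Y p"] subspace_diff[OF sub[OF p]] by (simp_all add: D_def)
    then show ?thesis using eq by simp
  qed
  have DT: "D X Y \<in> ?T" if "vector_field M X" "vector_field M Y" for X Y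
    unfolding D_def using tan that sub[OF p] by (simp add: subspace_diff)
  \<comment> \<open>\<open>Z\<close> realises the vector \<open>D X Y\<close> itself, so that the
    vanishing inner product is its squared length.\<close>
  obtain Z where Z: "vector_field M Z" "Z p = D X Y"
    using ext[OF p DT[OF X Y]] by blast
  have "g p (D X Y) (Z p) = - g p (Y p) (D Z X)"
    using skew[OF X Y Z(1)] sym[OF X Z(1)] by simp
  also have "\<dots> = - g p (D Z X) (Y p)"
    using gsym[OF DT[OF Z(1) X] vector_field_tangent[OF Y p]] by simp
  also have "\<dots> = g p (X p) (D Z Y)"
    using skew[OF Z(1) X Y] by simp
  also have "\<dots> = g p (X p) (D Y Z)"
    using sym[OF Z(1) Y] by simp
  also have "\<dots> = - g p (D X Y) (Z p)"
    using skew[OF Y X Z(1)] sym[OF X Y] by simp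
  finally have "g p (D X Y) (D X Y) = 0" using Z by simp
  then have "D X Y = 0"
    using riemannian_metric_pos[OF g p DT[OF X Y] DT[OF X Y] DT[OF X Y]] by force
  then show ?thesis by (simp add: D_def)
qed

text \<open>
  A connection on a submanifold whose Christoffel map \<open>G\<close> is defined on the ambient space; \<open>dG q u\<close>
  is the derivative of \<open>G\<close> in its base point \<open>q\<close> in direction \<open>u\<close>.
\<close>

locale christoffel =
  fixes M :: "'a::euclidean_space set" and g :: "'a \<Rightarrow> 'a \<Rightarrow> 'a \<Rightarrow> real"
    and G :: "'a \<Rightarrow> 'a \<Rightarrow> 'a \<Rightarrow> 'a" and dG :: "'a \<Rightarrow> 'a \<Rightarrow> 'a \<Rightarrow> 'a \<Rightarrow> 'a"
  assumes metric: "riemannian_metric M g"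
    and subspace_tangent: "p \<in> M \<Longrightarrow> subspace (tangent_space M p)"
    and extend: "p \<in> M \<Longrightarrow> v \<in> tangent_space M p \<Longrightarrow> \<exists>X. vector_field M X \<and> X p = v"
    and bilinear_G: "bilinear (G q)"
    and G_sym: "G q u v = G q v u"
    and smooth_G: "open U \<Longrightarrow> smooth_on U X \<Longrightarrow> smooth_on U Y \<Longrightarrow> smooth_on U (\<lambda>q. G q (X q) (Y q))"
    and deriv_G: "(X has_derivative X') (at q) \<Longrightarrow> (Y has_derivative Y') (at q) \<Longrightarrow>
      ((\<lambda>q. G q (X q) (Y q)) has_derivative
        (\<lambda>u. dG q u (X q) (Y q) + G q (X' u) (Y q) + G q (X q) (Y' u))) (at q)"
    and tangent_G: "vector_field M X \<Longrightarrow> vector_field M Y \<Longrightarrow> p \<in> M \<Longrightarrow>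
      dir_deriv M Y p (X p) + G p (X p) (Y p) \<in> tangent_space M p"
    and compatible: "vector_field M X \<Longrightarrow> vector_field M Y \<Longrightarrow> vector_field M Z \<Longrightarrow> p \<in> M \<Longrightarrow>
      dir_deriv M (\<lambda>q. g q (Y q) (Z q)) p (X p)
        = g p (dir_deriv M Y p (X p) + G p (X p) (Y p)) (Z p)
        + g p (Y p) (dir_deriv M Z p (X p) + G p (X p) (Z p))"
begin

definition conn :: "'a connection" where
  "conn X Y = (\<lambda>q. dir_deriv M Y q (X q) + G q (X q) (Y q))"

lemmas G_add_left = bilinear_ladd[OF bilinear_G]
  and G_add_right = bilinear_radd[OF bilinear_G]
  and G_diff_left = bilinear_lsub[OF bilinear_G]
  and G_scale_left = bilinear_lmul[OF bilinear_G]
  and G_scale_right = bilinear_rmul[OF bilinear_G]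

lemma local_ext_conn:
  assumes X: "vector_field M X" and ext: "local_ext M U X X'" "local_ext M U Y Y'"
  shows "local_ext M U (conn X Y) (\<lambda>q. frechet_derivative Y' (at q) (X' q) + G q (X' q) (Y' q))"
proof -
  have "dir_deriv M Y q (X q) = frechet_derivative Y' (at q) (X' q)" if "q \<in> M" "q \<in> U" for q
    using dir_deriv_eq[OF ext(2) that(2)] vector_field_tangent[OF X that(1)] ext(1) that
    unfolding local_ext_def by auto
  then show ?thesis
    using ext unfolding local_ext_def conn_def
    by (auto intro!: smooth_on_add smooth_on_frechet_derivative smooth_G)
qed

lemma vector_field_conn:
  assumes X: "vector_field M X" and Y: "vector_field M Y"
  shows "vector_field M (conn X Y)"
  unfolding vector_field_def smooth_fun_local_ext
proof (intro conjI ballI)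
  fix p assume p: "p \<in> M"
  obtain U X' Y' where "p \<in> U" "open U" and ext: "local_ext M U X X'" "local_ext M U Y Y'"
    by (rule common_ext[OF vector_field_local_ext[OF X p] vector_field_local_ext[OF Y p]], rule that)
  then show "\<exists>U F. p \<in> U \<and> local_ext M U (conn X Y) F"
    using local_ext_conn[OF X ext] by auto
  show "conn X Y p \<in> tangent_space M p"
    using tangent_G[OF X Y p] by (simp add: conn_def)
qed

lemma affine_connection_conn: "affine_connection M conn"
  unfolding affine_connection_def
proof (intro conjI allI impI ballI)
  show "vector_field M (conn X Y)" if "vector_field M X" "vector_field M Y" for X Y
    using vector_field_conn that .
next
  fix X Y Z p assume F: "vector_field M X" "vector_field M Y" "vector_field M Z" and p: "p \<in> M"
  obtain U Z' where Z: "p \<in> U" "local_ext M U Z Z'" using vector_field_local_ext[OF F(3) p] by blast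
  have T: "X p \<in> tangent_space M p" "Y p \<in> tangent_space M p"
    using F p vector_field_tangent by blast+
  have lin: "linear (frechet_derivative Z' (at p))"
    using Z smooth_on_imp_linear_deriv unfolding local_ext_def by blast
  show "conn (\<lambda>q. X q + Y q) Z p = conn X Z p + conn Y Z p"
    using T subspace_add[OF subspace_tangent[OF p] T]
    by (simp add: conn_def dir_deriv_eq[OF Z(2,1)] linear_add[OF lin] G_add_left)
  obtain V Y' Z'' where V: "p \<in> V" "open V" "local_ext M V Y Y'" "local_ext M V Z Z''"
    by (rule common_ext[OF vector_field_local_ext[OF F(2) p] vector_field_local_ext[OF F(3) p]], rule that)
  have sum: "local_ext M V (\<lambda>q. Y q + Z q) (\<lambda>q. Y' q + Z'' q)"
    using V unfolding local_ext_def by (auto intro: smooth_on_add)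
  have "frechet_derivative (\<lambda>q. Y' q + Z'' q) (at p) = (\<lambda>u. frechet_derivative Y' (at p) u + frechet_derivative Z'' (at p) u)"
    by (rule frechet_derivative_at[symmetric], intro has_derivative_add smooth_on_has_derivative[OF _ V(1)])
      (use V in \<open>auto simp: local_ext_def\<close>)
  then show "conn X (\<lambda>q. Y q + Z q) p = conn X Y p + conn X Z p"
    using T by (simp add: conn_def dir_deriv_eq[OF sum V(1)] dir_deriv_eq[OF V(3,1)] dir_deriv_eq[OF V(4,1)] G_add_right)
next
  fix f X Y p assume f: "smooth_fun M (f :: 'a \<Rightarrow> real)" and F: "vector_field M X" "vector_field M Y" and p: "p \<in> M"
  have T: "X p \<in> tangent_space M p" using F p vector_field_tangent by blast
  obtain V f' Y' where V: "p \<in> V" "open V" "local_ext M V f f'" "local_ext M V Y Y'"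
    by (rule common_ext[OF f[unfolded smooth_fun_local_ext, rule_format, OF p] vector_field_local_ext[OF F(2) p]], rule that)
  have D: "(f' has_derivative frechet_derivative f' (at p)) (at p)" "(Y' has_derivative frechet_derivative Y' (at p)) (at p)"
    using V smooth_on_has_derivative unfolding local_ext_def by blast+
  have eq: "f' p = f p" "Y' p = Y p" using V p unfolding local_ext_def by auto
  show "conn (\<lambda>q. f q *\<^sub>R X q) Y p = f p *\<^sub>R conn X Y p"
    using T subspace_scale[OF subspace_tangent[OF p] T, of "f p"]
    by (simp add: conn_def dir_deriv_eq[OF V(4,1)] linear_cmul[OF has_derivative_linear[OF D(2)]] G_scale_left
        scaleR_add_right)
  have prod: "local_ext M V (\<lambda>q. f q *\<^sub>R Y q) (\<lambda>q. f' q *\<^sub>R Y' q)"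
    using V unfolding local_ext_def by (auto intro: smooth_on_bilinear[OF _ bounded_bilinear_scaleR])
  have "frechet_derivative (\<lambda>q. f' q *\<^sub>R Y' q) (at p)
      = (\<lambda>u. f' p *\<^sub>R frechet_derivative Y' (at p) u + frechet_derivative f' (at p) u *\<^sub>R Y' p)"
    by (rule frechet_derivative_at[symmetric], rule has_derivative_scaleR[OF D])
  then show "conn X (\<lambda>q. f q *\<^sub>R Y q) p = dir_deriv M f p (X p) *\<^sub>R Y p + f p *\<^sub>R conn X Y p"
    using T by (simp add: conn_def dir_deriv_eq[OF prod V(1)] dir_deriv_eq[OF V(4,1)] dir_deriv_eq[OF V(3,1)]
        eq G_scale_right scaleR_add_right)
qed

text \<open>The torsion vanishes because the symmetric \<open>G\<close> cancels in the commutator;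
  the derivative terms left are the Lie bracket by definition.\<close>

lemma is_levi_civita_conn: "is_levi_civita M g conn"
  unfolding is_levi_civita_def
  using affine_connection_conn compatible by (auto simp: conn_def lie_bracket_def G_sym)

text \<open>\<open>levi_civita\<close> is an arbitrary choice. Existence comes from
  \<open>conn\<close>, and uniqueness fixes its values, though only for vector fields and at points
  of \<open>M\<close>.\<close>

lemma levi_civita_eq:
  assumes "vector_field M X" "vector_field M Y" "p \<in> M"
  shows "levi_civita M g X Y p = conn X Y p"
proof -
  have "is_levi_civita M g (levi_civita M g)"
    unfolding levi_civita_def by (rule someI[of "is_levi_civita M g", OF is_levi_civita_conn])
  from is_levi_civita_unique[OF this is_levi_civita_conn metric subspace_tangent extend assms]
  show ?thesis .
qed

section \<open>Curvature of the connection\<close>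

definition riem :: "'a \<Rightarrow> 'a \<Rightarrow> 'a \<Rightarrow> 'a \<Rightarrow> 'a" where
  "riem p u v w = dG p u v w - dG p v u w + G p u (G p v w) - G p v (G p u w)"

text \<open>\<open>W\<close> stands for the chosen Levi-Civita derivative of \<open>Z\<close> along
  \<open>Y\<close>, known to equal \<open>conn Y Z\<close> on \<open>M\<close> only. It is therefore
  differentiated through \<open>N\<close>, built from the extensions of \<open>Y\<close> and
  \<open>Z\<close>.\<close>

lemma conn_conn:
  assumes X: "vector_field M X" and Y: "vector_field M Y" and Z: "vector_field M Z" and p: "p \<in> M"
    and U: "p \<in> U" "open U" and ext: "local_ext M U X X'" "local_ext M U Y Y'" "local_ext M U Z Z'"
    and nab: "\<And>q. q \<in> M \<Longrightarrow> W q = conn Y Z q" and W: "vector_field M W"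
  shows "levi_civita M g X W p
    = frechet_derivative (\<lambda>q. frechet_derivative Z' (at q) (Y p)) (at p) (X p)
      + frechet_derivative Z' (at p) (frechet_derivative Y' (at p) (X p))
      + (dG p (X p) (Y p) (Z p) + G p (frechet_derivative Y' (at p) (X p)) (Z p)
          + G p (Y p) (frechet_derivative Z' (at p) (X p)))
      + G p (X p) (frechet_derivative Z' (at p) (Y p) + G p (Y p) (Z p))"
proof -
  have Xp: "X p \<in> tangent_space M p" using vector_field_tangent[OF X p] .
  have eq: "X' p = X p" "Y' p = Y p" "Z' p = Z p" using ext U p unfolding local_ext_def by auto
  define N where "N = (\<lambda>q. frechet_derivative Z' (at q) (Y' q) + G q (Y' q) (Z' q))"
  have N: "local_ext M U W N"
    using local_ext_conn[OF Y ext(2,3)] nab unfolding local_ext_def N_def by auto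
  have S: "smooth_on U Y'" "smooth_on U Z'" using ext unfolding local_ext_def by auto
  have "(N has_derivative (\<lambda>u. (frechet_derivative (\<lambda>q. frechet_derivative Z' (at q) (Y' p)) (at p) u
      + frechet_derivative Z' (at p) (frechet_derivative Y' (at p) u))
      + (dG p u (Y' p) (Z' p) + G p (frechet_derivative Y' (at p) u) (Z' p)
          + G p (Y' p) (frechet_derivative Z' (at p) u)))) (at p)"
    unfolding N_def
    by (intro has_derivative_add has_derivative_frechet_derivative[OF U(2) S(2,1) U(1)] deriv_G smooth_on_has_derivative[OF _ U(1)] S)
  note DN = frechet_derivative_at[OF this, symmetric]
  have "W p = N p" using N p U unfolding local_ext_def by simp
  then have "levi_civita M g X W p = frechet_derivative N (at p) (X p) + G p (X p) (N p)"
    using levi_civita_eq[OF X W p] dir_deriv_eq[OF N U(1) Xp] by (simp add: conn_def)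
  then show ?thesis
    by (simp add: DN) (simp add: N_def eq)
qed

lemma vector_field_levi_civita:
  "vector_field M X \<Longrightarrow> vector_field M Y \<Longrightarrow> vector_field M (levi_civita M g X Y)"
  using vector_field_conn vector_field_cong[of M "levi_civita M g X Y" "conn X Y"] levi_civita_eq by simp

text \<open>By symmetry of \<open>G\<close> the bracket is the difference of \<open>conn X Y\<close>
  and \<open>conn Y X\<close>, from which it inherits smoothness and tangency.\<close>

lemma vector_field_lie_bracket:
  assumes X: "vector_field M X" and Y: "vector_field M Y"
  shows "vector_field M (lie_bracket M X Y)"
proof -
  have lb: "lie_bracket M X Y q = conn X Y q - conn Y X q" for q
    by (simp add: lie_bracket_def conn_def G_sym)
  show ?thesis
    unfolding vector_field_def smooth_fun_local_ext
  proof (intro conjI ballI)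
    fix q assume q: "q \<in> M"
    obtain V F H where V: "q \<in> V" "open V" "local_ext M V (conn X Y) F" "local_ext M V (conn Y X) H"
      by (rule common_ext[OF vector_field_local_ext[OF vector_field_conn[OF X Y] q] vector_field_local_ext[OF vector_field_conn[OF Y X] q]], rule that)
    then have "local_ext M V (lie_bracket M X Y) (\<lambda>x. F x - H x)"
      unfolding local_ext_def lb by (auto intro: smooth_on_diff)
    then show "\<exists>U F. q \<in> U \<and> local_ext M U (lie_bracket M X Y) F" using V by blast
    show "lie_bracket M X Y q \<in> tangent_space M q"
      unfolding lb
      by (intro subspace_diff[OF subspace_tangent[OF q]] vector_field_tangent[OF vector_field_conn _] X Y q)
  qed
qed

text \<open>In the difference of the two expansions the second derivatives of \<open>Z\<close>
  cancel by symmetry, and so do the terms pairing a field with a first derivative of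
  \<open>Z\<close> under \<open>G\<close>. The first derivatives of \<open>X\<close> and
  \<open>Y\<close> combine to the bracket and are removed by the third summand of the curvature.
  Only a tensorial expression is left.\<close>

lemma curvature_eq:
  assumes X: "vector_field M X" and Y: "vector_field M Y" and Z: "vector_field M Z" and p: "p \<in> M"
  shows "curvature M g X Y Z p = riem p (X p) (Y p) (Z p)"
proof -
  let ?N = "levi_civita M g"
  obtain U1 X1 Y1 where 1: "p \<in> U1" "open U1" "local_ext M U1 X X1" "local_ext M U1 Y Y1"
    by (rule common_ext[OF vector_field_local_ext[OF X p] vector_field_local_ext[OF Y p]], rule that)
  obtain U2 Z1 where 2: "p \<in> U2" "local_ext M U2 Z Z1"
    using vector_field_local_ext[OF Z p] by blast
  define U where "U = U1 \<inter> U2"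
  have U: "p \<in> U" "open U" using 1 2 unfolding U_def local_ext_def by auto
  have ext: "local_ext M U X X1" "local_ext M U Y Y1" "local_ext M U Z Z1"
    using 1 2 U(2) local_ext_subset[of M _ _ _ U] unfolding U_def by auto
  have T: "X p \<in> tangent_space M p" "Y p \<in> tangent_space M p" using X Y p vector_field_tangent by blast+
  have vlb: "vector_field M (lie_bracket M X Y)" using vector_field_lie_bracket[OF X Y] .
  have lbp: "lie_bracket M X Y p = frechet_derivative Y1 (at p) (X p) - frechet_derivative X1 (at p) (Y p)"
    using T by (simp add: lie_bracket_def dir_deriv_eq[OF ext(1) U(1)] dir_deriv_eq[OF ext(2) U(1)])
  have lin: "linear (frechet_derivative Z1 (at p))"
    using ext U smooth_on_imp_linear_deriv unfolding local_ext_def by blast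
  have "?N (lie_bracket M X Y) Z p
     = frechet_derivative Z1 (at p) (lie_bracket M X Y p) + G p (lie_bracket M X Y p) (Z p)"
    using levi_civita_eq[OF vlb Z p] dir_deriv_eq[OF ext(3) U(1)] vlb p vector_field_tangent
    by (metis conn_def)
  moreover have "frechet_derivative (\<lambda>q. frechet_derivative Z1 (at q) (Y p)) (at p) (X p)
      = frechet_derivative (\<lambda>q. frechet_derivative Z1 (at q) (X p)) (at p) (Y p)"
    by (rule second_derivative_symmetric[OF U(2,1)]) (use ext in \<open>auto simp: local_ext_def\<close>)
  moreover note conn_conn[OF X Y Z p U ext levi_civita_eq[OF Y Z] vector_field_levi_civita[OF Y Z]]
    conn_conn[OF Y X Z p U ext(2,1,3) levi_civita_eq[OF X Z] vector_field_levi_civita[OF X Z]]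
  ultimately show ?thesis
    by (simp add: curvature_def Let_def riem_def lbp linear_diff[OF lin] G_add_right G_diff_left)
qed

lemma curvature_tangent:
  assumes X: "vector_field M X" and Y: "vector_field M Y" and Z: "vector_field M Z" and p: "p \<in> M"
  shows "curvature M g X Y Z p \<in> tangent_space M p"
  unfolding curvature_def Let_def
  by (intro subspace_diff[OF subspace_tangent[OF p]] vector_field_tangent[OF vector_field_levi_civita p]
      vector_field_levi_civita vector_field_lie_bracket X Y Z p)

lemma
  assumes "p \<in> M" "u \<in> tangent_space M p" "v \<in> tangent_space M p" "w \<in> tangent_space M p"
  shows curvature_at_eq: "curvature_at M g p u v w = riem p u v w"
    and riem_tangent: "riem p u v w \<in> tangent_space M p"
proof -
  have ext: "vector_field M (extend_field M p v)" "extend_field M p v p = v" if "v \<in> tangent_space M p" for v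
    using someI_ex[OF extend[OF assms(1) that]] unfolding extend_field_def by auto
  show *: "curvature_at M g p u v w = riem p u v w"
    unfolding curvature_at_def using curvature_eq ext assms by simp
  show "riem p u v w \<in> tangent_space M p"
    unfolding *[symmetric] curvature_at_def using curvature_tangent ext assms by simp
qed

end

text \<open>Expanding \<open>P x\<close> in the basis of \<open>V\<close> chosen by
  \<open>trace_on\<close> and exchanging sums shows that the trace on \<open>V\<close> is the
  ambient trace of \<open>L\<close> after the projection \<open>P\<close>. The separate
  \<open>f\<close> accommodates \<open>curvature_at\<close>, whose formula is available for tangent
  vectors only.\<close>

lemma trace_on_eq:
  fixes L :: "'a::euclidean_space \<Rightarrow> 'a"
  assumes V: "subspace V" and L: "linear L" "\<And>x. x \<in> V \<Longrightarrow> L x \<in> V" and eq: "\<And>x. x \<in> V \<Longrightarrow> f x = L x"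
    and P: "linear P" "\<And>x. P x \<in> V" "\<And>x. x \<in> V \<Longrightarrow> P x = x"
  shows "trace_on V f = (\<Sum>e\<in>Basis. e \<bullet> L (P e))"
proof -
  define B where "B = (SOME B. independent B \<and> span B = V)"
  have "\<exists>B. independent B \<and> span B = V"
    using basis_exists[of V] span_subspace[OF _ _ V] by metis
  then have B: "independent B" "span B = V"
    unfolding B_def by (rule someI_ex[THEN conjunct1], rule someI_ex[THEN conjunct2])
  have fin: "finite B" using B independent_imp_finite by blast
  \<comment> \<open>The coordinate functionals of \<open>B\<close>, made linear on the whole space
    by projecting first.\<close>
  define \<phi> where "\<phi> = (\<lambda>b x. representation B (P x) b)"
  have lin\<phi>: "linear (\<phi> b)" for b
    using P(1,2) B unfolding \<phi>_def
    by (auto intro!: linearI simp: linear_add linear_cmul representation_add representation_scale)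
  have P\<phi>: "P x = (\<Sum>b\<in>B. \<phi> b x *\<^sub>R b)" for x
    using sum_representation_eq[OF B(1) _ fin subset_refl, of "P x"] P(2)[of x] B(2)
    by (simp add: \<phi>_def)
  have "(\<Sum>e\<in>Basis. e \<bullet> L (P e)) = (\<Sum>e\<in>Basis. \<Sum>b\<in>B. \<phi> b e * (e \<bullet> L b))"
    using L(1) by (subst P\<phi>) (simp add: linear_sum linear_cmul inner_sum_right)
  also have "\<dots> = (\<Sum>b\<in>B. \<Sum>e\<in>Basis. \<phi> b e * (e \<bullet> L b))" by (rule sum.swap)
  also have "\<dots> = (\<Sum>b\<in>B. \<phi> b (L b))"
  proof (rule sum.cong[OF refl])
    fix b assume "b \<in> B"
    have "\<phi> b (L b) = \<phi> b (\<Sum>e\<in>Basis. (L b \<bullet> e) *\<^sub>R e)" by (simp add: euclidean_representation)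
    also have "\<dots> = (\<Sum>e\<in>Basis. \<phi> b e * (e \<bullet> L b))"
      using lin\<phi>[of b] by (simp add: linear_sum linear_cmul inner_commute mult.commute)
    finally show "(\<Sum>e\<in>Basis. \<phi> b e * (e \<bullet> L b)) = \<phi> b (L b)" by simp
  qed
  also have "\<dots> = (\<Sum>b\<in>B. representation B (f b) b)"
    using L(2) P(3) B eq by (intro sum.cong) (auto simp: \<phi>_def span_base)
  finally show ?thesis by (simp add: trace_on_def B_def Let_def)
qed

section \<open>Matrix algebra\<close>

lemma bounded_bilinear_matmul:
  "bounded_bilinear ((**) :: real^'b::finite^'a::finite \<Rightarrow> real^'c::finite^'b \<Rightarrow> real^'c^'a)"
  unfolding bilinear_conv_bounded_bilinear[symmetric] bilinear_def
  by (auto intro!: linearI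
      simp: vec_eq_iff matrix_matrix_mult_def sum.distrib sum_distrib_left algebra_simps)

lemma bounded_linear_transpose: "bounded_linear (transpose :: real^'b::finite^'a::finite \<Rightarrow> real^'a^'b)"
  unfolding linear_conv_bounded_linear[symmetric]
  by (auto intro!: linearI simp: transpose_def vec_eq_iff)

interpretation matmul: bounded_bilinear "(**) :: real^'b::finite^'a::finite \<Rightarrow> real^'c::finite^'b \<Rightarrow> real^'c^'a"
  by (rule bounded_bilinear_matmul)

lemmas linear_transpose = bounded_linear.linear[OF bounded_linear_transpose]

lemmas transpose_add = linear_add[OF linear_transpose]
  and transpose_diff = linear_diff[OF linear_transpose]
  and transpose_minus = linear_neg[OF linear_transpose]
  and transpose_scaleR = linear_cmul[OF linear_transpose]
  and transpose_zero = linear_0[OF linear_transpose]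
  and transpose_sum = linear_sum[OF linear_transpose]
  and has_derivative_transpose = bounded_linear.has_derivative[OF bounded_linear_transpose]
  and has_vector_derivative_transpose = bounded_linear.has_vector_derivative[OF bounded_linear_transpose]

text \<open>As rewrite rules these distribute products and transposes over sums and scalars and nest
  products to the right. Cancellation rules such as \<open>stiefel_cancel\<close> are stated in this
  normal form.\<close>

lemmas matrix_ring_simps = matmul.add_left matmul.add_right matmul.diff_left matmul.diff_right
  matmul.minus_left matmul.minus_right matmul.scaleR_left matmul.scaleR_right matmul.zero_left matmul.zero_right
  transpose_add transpose_diff transpose_minus transpose_scaleR transpose_zero
  matrix_transpose_mul transpose_transpose matrix_mul_assoc[symmetric] transpose_mat
  scaleR_add_right scaleR_diff_right scaleR_scaleR scaleR_minus_right

lemma trace_transpose_mult: "trace (transpose A ** B) = A \<bullet> (B :: real^'b::finite^'a::finite)"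
  unfolding trace_def matrix_matrix_mult_def transpose_def inner_vec_def
  by (simp add: sum.swap[of _ "UNIV :: 'b set"])

lemma inner_matmul_left: "(A ** X) \<bullet> Y = X \<bullet> (transpose A ** (Y :: real^'b::finite^'a::finite))"
  by (simp flip: trace_transpose_mult add: matrix_transpose_mul matrix_mul_assoc)

lemma inner_transpose: "transpose A \<bullet> transpose B = A \<bullet> (B :: real^'b::finite^'a::finite)"
  unfolding trace_transpose_mult[symmetric] transpose_transpose
  by (subst trace_mul_sym) (simp add: trace_transpose_mult inner_commute)

text \<open>Transposing both arguments preserves the inner product, yet changes its sign
  here.\<close>

lemma inner_sym_skew:
  assumes "transpose S = S" "transpose C = - (C :: real^'a::finite^'a)"
  shows "S \<bullet> C = 0"
  using inner_transpose[of S C] assms by simp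

lemma axis_matmul: "axis i (axis j 1) ** M = axis i (M $ j)" for M :: "real^'b::finite^'a::finite"
  by (simp add: vec_eq_iff matrix_matrix_mult_def axis_def if_distrib[of "\<lambda>x. x * _"] cong: if_cong)

lemma transpose_axis: "transpose (axis i (axis j x)) = axis j (axis i (x :: real))"
  by (auto simp: vec_eq_iff transpose_def axis_def)

lemma matrix_expand: "M = (\<Sum>i\<in>UNIV. \<Sum>j\<in>UNIV. (M $ i $ j) *\<^sub>R axis i (axis j 1))"
  for M :: "real^'b::finite^'a::finite"
  by (simp add: vec_eq_iff axis_def if_distrib[of "\<lambda>x. x $ _"] if_distrib[of "\<lambda>x. _ * x"] sum.If_cases cong: if_cong)

section \<open>Curves of orthogonal matrices\<close>

text \<open>Such a curve moves a point of the Stiefel manifold within the manifold. No one-parameter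
  group is asked for, so the notion is closed under pointwise products.\<close>

definition orthogonal_curve :: "(real \<Rightarrow> real^'n::finite^'n) \<Rightarrow> real^'n^'n \<Rightarrow> bool" where
  "orthogonal_curve R \<Omega> \<longleftrightarrow> smooth_on UNIV R \<and> (\<forall>t. transpose (R t) ** R t = mat 1) \<and>
     R 0 = mat 1 \<and> (R has_vector_derivative \<Omega>) (at 0)"

lemma orthogonal_curve_const: "orthogonal_curve (\<lambda>t. mat 1) 0"
  by (simp add: orthogonal_curve_def smooth_on_const)

lemma orthogonal_curve_mult:
  assumes "orthogonal_curve R A" "orthogonal_curve S B"
  shows "orthogonal_curve (\<lambda>t. R t ** S t) (A + B)"
proof -
  have "transpose (R t) ** R t = mat 1" "transpose (S t) ** S t = mat 1" for t
    using assms unfolding orthogonal_curve_def by auto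
  then have "transpose (R t ** S t) ** (R t ** S t) = mat 1" for t
    by (simp add: matrix_transpose_mul) (metis matrix_mul_assoc matrix_mul_lid)
  then show ?thesis
    using assms matmul.has_vector_derivative[of R A 0 UNIV S B]
    unfolding orthogonal_curve_def
    by (auto intro: smooth_on_bilinear[OF _ bounded_bilinear_matmul] simp: add.commute)
qed

text \<open>If \<open>S ** S ** S = - S\<close> then \<open>exp (\<theta> S) = 1 + sin \<theta> S + (1 - cos \<theta>) S ** S\<close>.\<close>

lemma orthogonal_curve_rotation:
  assumes S: "transpose S = - S" "S ** (S ** S) = - S"
  shows "\<exists>R. orthogonal_curve R (c *\<^sub>R S)"
proof -
  define R where "R = (\<lambda>t. mat 1 + sin (c * t) *\<^sub>R S + (1 - cos (c * t)) *\<^sub>R (S ** S))"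
  have "transpose (R t) ** R t = mat 1" for t
  proof -
    have S4: "S ** (S ** (S ** S)) = - (S ** S)" using S(2) by (simp add: matmul.minus_right)
    have "transpose (mat 1 + s *\<^sub>R S + (1 - k) *\<^sub>R (S ** S)) ** (mat 1 + s *\<^sub>R S + (1 - k) *\<^sub>R (S ** S))
      = mat 1 + (2 * (1 - k) - (1 - k) * (1 - k) - s * s) *\<^sub>R (S ** S)" for s k :: real
      by (simp add: matrix_ring_simps S S4) (simp add: vec_eq_iff algebra_simps)
    then have "transpose (R t) ** R t = mat 1 + (2 * (1 - cos (c * t)) - (1 - cos (c * t)) * (1 - cos (c * t))
        - sin (c * t) * sin (c * t)) *\<^sub>R (S ** S)"
      by (simp add: R_def)
    \<comment> \<open>With \<open>s\<close> the sine and \<open>k\<close> the cosine, the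
      coefficient is \<open>1 - k * k - s * s\<close>.\<close>
    also have "2 * (1 - cos (c * t)) - (1 - cos (c * t)) * (1 - cos (c * t)) - sin (c * t) * sin (c * t) = 0"
      using sin_cos_squared_add3[of "c * t"] by (simp add: algebra_simps)
    finally show ?thesis by simp
  qed
  moreover have "smooth_on UNIV R"
    unfolding R_def
    by (intro smooth_on_add smooth_on_diff smooth_on_const smooth_on_sin_cos smooth_on_bilinear[OF _ bounded_bilinear_scaleR] open_UNIV)
  moreover have "(R has_vector_derivative c *\<^sub>R S) (at 0)"
    unfolding R_def by (auto intro!: derivative_eq_intros)
  ultimately show ?thesis unfolding orthogonal_curve_def R_def by auto
qed

text \<open>A skew matrix is a linear combination of generators of rotations in coordinate planes.
  Each generator satisfies \<open>S ** (S ** S) = - S\<close> and so has a curve by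
  \<open>orthogonal_curve_rotation\<close>; multiplying the curves adds the velocities.\<close>

lemma orthogonal_curve_skew:
  assumes "transpose \<Omega> = - \<Omega>"
  shows "\<exists>R. orthogonal_curve R \<Omega>"
proof -
  let ?L = "\<lambda>\<Omega>. \<exists>R. orthogonal_curve R \<Omega>"
  let ?S = "\<lambda>i j. axis i (axis j 1) - axis j (axis i 1) :: real^'a^'a"
  have sum: "?L (\<Sum>i\<in>I. f i)" if "finite I" "\<And>i. i \<in> I \<Longrightarrow> ?L (f i)" for I :: "'a set" and f
    using that
  proof (induction I rule: finite_induct)
    case empty then show ?case using orthogonal_curve_const by auto
  next
    case (insert i I)
    then have "?L (f i)" "?L (\<Sum>i\<in>I. f i)" by auto
    then show ?case using insert orthogonal_curve_mult by fastforce
  qed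
  have gen: "?L (c *\<^sub>R ?S i j)" for c i j
  proof (cases "i = j")
    case True then show ?thesis using orthogonal_curve_const by auto
  next
    case False
    have "?S i j ** (?S i j ** ?S i j) = - ?S i j"
      using False by (simp add: matmul.diff_left axis_matmul) (auto simp: axis_def vec_eq_iff)
    moreover have "transpose (?S i j) = - ?S i j"
      by (simp add: transpose_diff transpose_axis)
    ultimately show ?thesis by (rule orthogonal_curve_rotation[rotated])
  qed
  \<comment> \<open>The sum runs over ordered pairs and meets each coordinate plane twice, hence the
    factor 1/2.\<close>
  have "\<Omega> = (1/2) *\<^sub>R (\<Omega> - transpose \<Omega>)" using assms by (simp flip: scaleR_2)
  also have "\<dots> = (\<Sum>i\<in>UNIV. \<Sum>j\<in>UNIV. (\<Omega> $ i $ j / 2) *\<^sub>R ?S i j)"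
    by (subst (1 2) matrix_expand[of \<Omega>])
      (simp add: transpose_sum transpose_scaleR transpose_axis sum_subtractf[symmetric] scaleR_sum_right scaleR_diff_right)
  finally have eq: "\<Omega> = (\<Sum>i\<in>UNIV. \<Sum>j\<in>UNIV. (\<Omega> $ i $ j / 2) *\<^sub>R ?S i j)" .
  show ?thesis
    by (subst eq) (intro sum finite gen)
qed

section \<open>The Stiefel manifold\<close>

lemma stiefel_iff: "q \<in> stiefel \<longleftrightarrow> transpose q ** q = mat 1"
  by (simp add: stiefel_def)

lemma stiefel_cancel: "q \<in> stiefel \<Longrightarrow> transpose q ** (q ** z) = z"
  by (simp add: stiefel_iff matrix_mul_assoc)

text \<open>The curve \<open>R t ** q\<close> stays in the manifold and has velocity
  \<open>\<Omega> ** q\<close>. The field is linear, hence smooth on the whole ambient space; such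
  fields serve to extend tangent vectors.\<close>

lemma skew_field:
  fixes \<Omega> :: "real^'n::finite^'n"
  assumes "transpose \<Omega> = - \<Omega>"
  shows "vector_field (stiefel :: (real^'p::finite^'n) set) (\<lambda>x. \<Omega> ** x)"
  unfolding vector_field_def
proof (intro conjI ballI)
  show "smooth_fun (stiefel :: (real^'p^'n) set) (\<lambda>x. \<Omega> ** x)"
    by (intro smooth_fun_if_smooth_on smooth_on_bounded_linear matmul.bounded_linear_right open_UNIV)
  fix q :: "real^'p^'n" assume q: "q \<in> stiefel"
  obtain R where R: "orthogonal_curve R \<Omega>" using orthogonal_curve_skew[OF assms] by blast
  have "transpose (R t ** q) ** (R t ** q) = mat 1" for t
  proof -
    have "transpose (R t) ** (R t ** q) = q"
      using R unfolding orthogonal_curve_def by (simp add: matrix_mul_assoc)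
    then show ?thesis using q by (simp add: matrix_transpose_mul matrix_mul_assoc[symmetric] stiefel_iff)
  qed
  moreover have "smooth_on UNIV (\<lambda>t. R t ** q)"
    using R unfolding orthogonal_curve_def
    by (intro smooth_on_bilinear[OF _ bounded_bilinear_matmul] smooth_on_const) auto
  then have "smooth_on {-1<..<1} (\<lambda>t. R t ** q)" by (rule smooth_on_subset) simp
  moreover have "((\<lambda>t. R t ** q) has_vector_derivative \<Omega> ** q) (at 0)"
    using R matmul.has_vector_derivative[of R \<Omega> 0 UNIV "\<lambda>t. q" 0] unfolding orthogonal_curve_def
    by (simp add: matmul.zero_right)
  ultimately have "smooth_curve_in stiefel q (\<Omega> ** q) (\<lambda>t. R t ** q)"
    using R unfolding smooth_curve_in_def orthogonal_curve_def stiefel_iff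
    by (auto intro!: exI[of _ 1] simp: stiefel_iff)
  then show "\<Omega> ** q \<in> tangent_space stiefel q"
    unfolding tangent_space_def by blast
qed

lemma tangent_space_stiefel_imp:
  assumes "v \<in> tangent_space stiefel q"
  shows "transpose q ** v + transpose v ** q = (0 :: real^'p::finite^'p)"
proof -
  obtain \<gamma> where \<gamma>: "smooth_curve_in stiefel q v \<gamma>" using assms unfolding tangent_space_def by blast
  then have D: "(\<gamma> has_vector_derivative v) (at 0)" and \<gamma>0: "\<gamma> 0 = q" and q: "q \<in> stiefel"
    using smooth_curve_in_base unfolding smooth_curve_in_def by auto
  have "((\<lambda>t. transpose (\<gamma> t) ** \<gamma> t) has_vector_derivative (transpose q ** v + transpose v ** q)) (at 0)"
    using matmul.has_vector_derivative[OF has_vector_derivative_transpose[OF D] D] \<gamma>0 by simp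
  moreover have "((\<lambda>t. transpose (\<gamma> t) ** \<gamma> t) has_vector_derivative 0) (at 0)"
  proof -
    have "eventually (\<lambda>t. transpose (\<gamma> t) ** \<gamma> t = mat 1) (at 0)"
      using smooth_curve_in_eventually[OF \<gamma>] by (simp add: stiefel_iff)
    moreover have "transpose (\<gamma> 0) ** \<gamma> 0 = mat 1" using \<gamma>0 q by (simp add: stiefel_iff)
    ultimately show ?thesis
      unfolding has_vector_derivative_def
      using has_derivative_transform_eventually[of "\<lambda>t. mat 1" "\<lambda>t. t *\<^sub>R 0" 0 UNIV "\<lambda>t. transpose (\<gamma> t) ** \<gamma> t"]
      by (simp add: eq_commute)
  qed
  ultimately show ?thesis using vector_derivative_unique_at by blast
qed

lemma stiefel_extend:
  assumes q: "q \<in> stiefel" and v: "transpose q ** v + transpose v ** q = (0 :: real^'p::finite^'p)"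
  shows "\<exists>X. vector_field stiefel X \<and> X q = v"
proof -
  \<comment> \<open>The first term maps \<open>q\<close> to \<open>v\<close>, the second makes the
    sum skew, and the third, itself skew, removes what the second adds to the image of
    \<open>q\<close>.\<close>
  define \<Omega> where "\<Omega> = v ** transpose q - q ** transpose v - q ** (transpose q ** (v ** transpose q))"
  have vq: "transpose v ** q = - (transpose q ** v)" using v by (simp add: eq_neg_iff_add_eq_0 add.commute)
  have vq': "transpose v ** (q ** z) = - (transpose q ** (v ** z))" for z :: "real^'c::finite^'p"
    using arg_cong[OF vq, of "\<lambda>x. x ** z"] by (simp add: matmul.minus_left matrix_mul_assoc)
  have "transpose \<Omega> = - \<Omega>"
    unfolding \<Omega>_def by (simp add: matrix_ring_simps vq')
  then have "vector_field stiefel (\<lambda>x::real^'p^_. \<Omega> ** x)" by (rule skew_field)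
  moreover have "\<Omega> ** q = v"
    unfolding \<Omega>_def using q by (simp add: matrix_ring_simps vq stiefel_iff)
  ultimately show ?thesis by blast
qed

lemma tangent_space_stiefel:
  "q \<in> stiefel \<Longrightarrow> tangent_space stiefel q = {v :: real^'p::finite^'n::finite. transpose q ** v + transpose v ** q = 0}"
  using tangent_space_stiefel_imp stiefel_extend vector_field_tangent by blast

text \<open>
  The equations \<open>x\<^sup>T x = 1\<close> take values in the symmetric \<open>p \<times> p\<close> matrices; multiplication by a fixed
  \<open>q\<close> in the manifold embeds these into the ambient space, where the defining map has to live.
\<close>

lemma smooth_submanifold_stiefel: "\<exists>d. smooth_submanifold d (stiefel :: (real^'p::finite^'n::finite) set)"
proof -
  define Sym where "Sym = {S :: real^'p^'p. transpose S = S}"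
  have Sym: "subspace Sym"
    unfolding Sym_def subspace_def by (simp add: transpose_zero transpose_add transpose_scaleR)
  have lin: "linear ((**) q :: real^'p^'p \<Rightarrow> real^'p^'n)" for q
    using matmul.bounded_linear_right bounded_linear.linear by blast
  have dimW: "dim ((**) q ` Sym) = dim Sym" if "q \<in> stiefel" for q :: "real^'p^'n"
    by (rule dim_image_eq[OF lin]) (use stiefel_cancel[OF that] in \<open>metis inj_onI\<close>)
  show ?thesis
  \<comment> \<open>Without a bound on the number of columns the set may be empty, and then every
    \<open>d\<close> qualifies.\<close>
  proof (cases "(stiefel :: (real^'p^'n) set) = {}")
    case True
    then show ?thesis by (simp add: smooth_submanifold_def)
  next
    case False
    \<comment> \<open>A point of the manifold embeds \<open>Sym\<close> in the ambient space, so the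
      natural-number difference of the dimensions is exact.\<close>
    then have le: "dim Sym \<le> DIM(real^'p^'n)"
      using dimW dim_subset_UNIV by (metis ex_in_conv)
    have "smooth_submanifold (DIM(real^'p^'n) - dim Sym) (stiefel :: (real^'p^'n) set)"
      unfolding smooth_submanifold_def
    proof (rule ballI, intro exI conjI)
      fix q :: "real^'p^'n" assume q: "q \<in> stiefel"
      define \<Phi> where "\<Phi> = (\<lambda>x :: real^'p^'n. q ** (transpose x ** x - mat 1))"
      have inj: "q ** z = 0 \<longleftrightarrow> z = 0" for z :: "real^'p^'p"
        using stiefel_cancel[OF q, of z] matmul.zero_right by auto
      show "open (UNIV :: (real^'p^'n) set)" "q \<in> UNIV" by auto
      show "subspace ((**) q ` Sym)" using linear_subspace_image[OF lin Sym] .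
      show "dim ((**) q ` Sym) + (DIM(real^'p^'n) - dim Sym) = DIM(real^'p^'n)"
        using dimW[OF q] le by simp
      show "smooth_on UNIV \<Phi>"
        unfolding \<Phi>_def
        by (intro smooth_on_bilinear[OF _ bounded_bilinear_matmul] smooth_on_const smooth_on_diff
            smooth_on_bounded_linear[OF _ bounded_linear_transpose] smooth_on_ident open_UNIV)
      show "\<Phi> ` UNIV \<subseteq> (**) q ` Sym"
        unfolding \<Phi>_def Sym_def by (auto simp: transpose_diff matrix_transpose_mul)
      show "stiefel \<inter> UNIV = {x \<in> UNIV. \<Phi> x = 0}"
        unfolding \<Phi>_def by (simp add: inj stiefel_def)
      show "\<forall>x\<in>stiefel \<inter> UNIV. range (frechet_derivative \<Phi> (at x)) = (**) q ` Sym"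
      proof
        fix x :: "real^'p^'n" assume "x \<in> stiefel \<inter> UNIV"
        then have x: "x \<in> stiefel" by simp
        have "(\<Phi> has_derivative (\<lambda>v. q ** (transpose x ** v + transpose v ** x))) (at x)"
          unfolding \<Phi>_def
        proof (rule bounded_linear.has_derivative[OF matmul.bounded_linear_right])
          have "((\<lambda>x. transpose x ** x - mat 1) has_derivative (\<lambda>v. transpose x ** v + transpose v ** x - 0)) (at x)"
            by (intro has_derivative_diff has_derivative_const matmul.FDERIV has_derivative_transpose has_derivative_ident)
          then show "((\<lambda>x. transpose x ** x - mat 1) has_derivative (\<lambda>v. transpose x ** v + transpose v ** x)) (at x)"
            by simp
        qed
        note D = frechet_derivative_at[OF this, symmetric]
        show "range (frechet_derivative \<Phi> (at x)) = (**) q ` Sym"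
        proof (intro equalityI subsetI)
          fix y assume "y \<in> range (frechet_derivative \<Phi> (at x))"
          then show "y \<in> (**) q ` Sym"
            unfolding D Sym_def by (auto simp: transpose_add matrix_transpose_mul add.commute)
        next
          fix y assume "y \<in> (**) q ` Sym"
          then obtain S where S: "y = q ** S" "transpose S = S" unfolding Sym_def by auto
          have "transpose x ** ((1/2) *\<^sub>R (x ** S)) + transpose ((1/2) *\<^sub>R (x ** S)) ** x = S"
            using S(2) x by (simp add: matrix_ring_simps stiefel_cancel[OF x] stiefel_iff flip: scaleR_left_distrib)
          then have "y = frechet_derivative \<Phi> (at x) ((1/2) *\<^sub>R (x ** S))"
            unfolding D S(1) by (simp only:)
          then show "y \<in> range (frechet_derivative \<Phi> (at x))"
            by (rule range_eqI)
        qed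
      qed
    qed
    then show ?thesis by blast
  qed
qed

section \<open>The connection of the metric on the Stiefel manifold\<close>

lemma stiefel_metric_inner:
  "stiefel_metric a0 a1 q v w = a0 * (v \<bullet> w) + (a1 - a0) * ((transpose q ** v) \<bullet> (transpose q ** w))"
  unfolding stiefel_metric_def
  by (simp flip: trace_transpose_mult add: matrix_transpose_mul matrix_mul_assoc)

lemma tangent_transpose:
  fixes q v :: "real^'p::finite^'n::finite" and z :: "real^'c::finite^'p"
  assumes "transpose q ** v + transpose v ** q = (0 :: real^'p::finite^'p)"
  shows "transpose v ** q = - (transpose q ** v)"
    and "transpose v ** (q ** z) = - (transpose q ** (v ** z))"
proof -
  show *: "transpose v ** q = - (transpose q ** v)"
    using assms by (simp add: eq_neg_iff_add_eq_0 add.commute)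
  show "transpose v ** (q ** z) = - (transpose q ** (v ** z))"
    using arg_cong[OF *, of "\<lambda>x. x ** z"] by (simp add: matmul.minus_left matrix_mul_assoc)
qed

text \<open>For \<open>q\<close> in the manifold this is the orthogonal projection onto the matrices
  \<open>z\<close> with \<open>transpose q ** z = 0\<close>.\<close>

definition horizontal :: "real^'p::finite^'n::finite \<Rightarrow> real^'p^'n \<Rightarrow> real^'p^'n" where
  "horizontal q z = z - q ** (transpose q ** z)"

text \<open>\<open>b\<close> stands for \<open>1 - \<alpha>\<close>. The first term is the normal
  correction for the embedded Euclidean metric, which is the case \<open>b = 0\<close> up to scale;
  the second accounts for the change of the metric along \<open>q\<close>.\<close>

definition stiefel_gamma :: "real \<Rightarrow> real^'p::finite^'n::finite \<Rightarrow> real^'p^'n \<Rightarrow> real^'p^'n \<Rightarrow> real^'p^'n" where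
  "stiefel_gamma b q v w = (1/2) *\<^sub>R (q ** (transpose v ** w + transpose w ** v))
     - b *\<^sub>R horizontal q (v ** (transpose q ** w) + w ** (transpose q ** v))"

text \<open>The base point enters \<open>horizontal\<close> through two factors with a minus sign;
  differentiating these turns \<open>- b\<close> into \<open>+ b\<close> in the middle term.\<close>

definition stiefel_dgamma ::
    "real \<Rightarrow> real^'p::finite^'n::finite \<Rightarrow> real^'p^'n \<Rightarrow> real^'p^'n \<Rightarrow> real^'p^'n \<Rightarrow> real^'p^'n" where
  "stiefel_dgamma b q u v w = (1/2) *\<^sub>R (u ** (transpose v ** w + transpose w ** v))
     + b *\<^sub>R (u ** (transpose q ** (v ** (transpose q ** w) + w ** (transpose q ** v)))
       + q ** (transpose u ** (v ** (transpose q ** w) + w ** (transpose q ** v))))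
     - b *\<^sub>R horizontal q (v ** (transpose u ** w) + w ** (transpose u ** v))"

lemma smooth_on_matmul:
  "open S \<Longrightarrow> smooth_on S f \<Longrightarrow> smooth_on S g \<Longrightarrow>
    smooth_on S (\<lambda>x. f x ** (g x :: real^'c::finite^'b::finite) :: real^'c^'a::finite)"
  by (rule smooth_on_bilinear[OF _ bounded_bilinear_matmul])

lemma smooth_on_transpose:
  "open S \<Longrightarrow> smooth_on S f \<Longrightarrow> smooth_on S (\<lambda>x. transpose (f x :: real^'b::finite^'a::finite))"
  by (rule smooth_on_linear_compose[OF _ bounded_linear_transpose])

lemma smooth_on_inner:
  "open S \<Longrightarrow> smooth_on S f \<Longrightarrow> smooth_on S g \<Longrightarrow> smooth_on S (\<lambda>x. f x \<bullet> (g x :: 'b::real_inner))"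
  by (rule smooth_on_bilinear[OF _ bounded_bilinear_inner])

lemma smooth_on_cmult: "open S \<Longrightarrow> smooth_on S f \<Longrightarrow> smooth_on S (\<lambda>x. c * f x :: real)"
  using smooth_on_scaleR_const[of S f c] by simp

lemmas smooth_intros = smooth_on_cmult smooth_on_add smooth_on_diff smooth_on_const smooth_on_scaleR_const smooth_on_matmul
  smooth_on_transpose smooth_on_inner smooth_on_ident

lemma bilinear_stiefel_gamma: "bilinear (stiefel_gamma b q)"
  unfolding bilinear_def stiefel_gamma_def horizontal_def
  by (auto intro!: linearI simp: matrix_ring_simps) (simp_all add: vec_eq_iff algebra_simps)

lemma stiefel_gamma_sym: "stiefel_gamma b q v w = stiefel_gamma b q w v"
  by (simp add: stiefel_gamma_def add.commute)

lemma smooth_on_stiefel_gamma: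
  "open U \<Longrightarrow> smooth_on U X \<Longrightarrow> smooth_on U Y \<Longrightarrow> smooth_on U (\<lambda>q. stiefel_gamma b q (X q) (Y q))"
  unfolding stiefel_gamma_def horizontal_def by (intro smooth_intros)

lemma has_derivative_stiefel_gamma:
  assumes "(X has_derivative X') (at q)" "(Y has_derivative Y') (at q)"
  shows "((\<lambda>q. stiefel_gamma b q (X q) (Y q)) has_derivative
        (\<lambda>u. stiefel_dgamma b q u (X q) (Y q) + stiefel_gamma b q (X' u) (Y q) + stiefel_gamma b q (X q) (Y' u))) (at q)"
  unfolding stiefel_gamma_def stiefel_dgamma_def horizontal_def
  by (rule has_derivative_eq_rhs,
      (rule has_derivative_add has_derivative_diff has_derivative_scaleR_right matmul.FDERIV has_derivative_transpose
        has_derivative_ident assms)+)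
    (simp add: fun_eq_iff matrix_ring_simps)

lemma transpose_mult_stiefel_gamma:
  assumes "q \<in> stiefel"
  shows "transpose q ** stiefel_gamma b q v w = (1/2) *\<^sub>R (transpose v ** w + transpose w ** v)"
  unfolding stiefel_gamma_def horizontal_def by (simp add: matrix_ring_simps stiefel_cancel[OF assms])

text \<open>Differentiating the tangency equation of \<open>Y\<close> along the manifold measures
  how far the directional derivative is from being tangent; the term of \<open>stiefel_gamma\<close>
  along \<open>q\<close> compensates exactly this.\<close>

lemma vector_field_stiefel_deriv:
  fixes Y :: "real^'p::finite^'n::finite \<Rightarrow> real^'p^'n"
  assumes Y: "vector_field stiefel Y" and p: "p \<in> stiefel" and v: "v \<in> tangent_space stiefel p"
  shows "transpose p ** dir_deriv stiefel Y p v + transpose (dir_deriv stiefel Y p v) ** p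
    = - (transpose v ** Y p + transpose (Y p) ** v)"
proof -
  obtain U F where F: "p \<in> U" "local_ext stiefel U Y F" using vector_field_local_ext[OF Y p] by blast
  have op: "open U" and S: "smooth_on U F" and eq: "F p = Y p" using F p unfolding local_ext_def by auto
  let ?f = "\<lambda>q. transpose q ** Y q + transpose (Y q) ** q"
  let ?F = "\<lambda>q. transpose q ** F q + transpose (F q) ** q"
  have F': "local_ext stiefel U ?f ?F"
    unfolding local_ext_def using F(2) op S unfolding local_ext_def by (auto intro!: smooth_intros)
  \<comment> \<open>The same function on the manifold is extended once by \<open>?F\<close> and once
    by zero, so both have the same derivative along \<open>v\<close>.\<close>
  have "local_ext stiefel U ?f (\<lambda>q. 0)"
    unfolding local_ext_def using op tangent_space_stiefel_imp[OF vector_field_tangent[OF Y]]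
    by (auto intro!: smooth_intros)
  from dir_deriv_eq[OF this F(1) v] have "frechet_derivative ?F (at p) v = frechet_derivative (\<lambda>q. 0) (at p) v"
    unfolding dir_deriv_eq[OF F' F(1) v] .
  moreover have "(?F has_derivative (\<lambda>u. (transpose p ** frechet_derivative F (at p) u + transpose u ** F p)
      + (transpose (F p) ** u + transpose (frechet_derivative F (at p) u) ** p))) (at p)"
    by (intro has_derivative_add matmul.FDERIV has_derivative_transpose has_derivative_ident
        smooth_on_has_derivative[OF S F(1)])
  note frechet_derivative_at[OF this, symmetric]
  ultimately show ?thesis
    using dir_deriv_eq[OF F(2,1) v] eq by (simp add: eq_neg_iff_add_eq_0 algebra_simps)
qed

text \<open>For \<open>a1 = (1 - b) * a0\<close> the left side is, up to the factor
  \<open>a0\<close>, the metric of the Christoffel value and \<open>z\<close>. Terms pairing a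
  symmetric matrix with the skew \<open>transpose q ** z\<close> vanish, so only part of the
  \<open>b\<close> term survives.\<close>

lemma metric_stiefel_gamma:
  fixes q :: "real^'p::finite^'n::finite"
  assumes q: "q \<in> stiefel" and z: "transpose q ** z + transpose z ** q = 0"
    and x: "transpose q ** x + transpose x ** q = 0" and y: "transpose q ** y + transpose y ** q = 0"
  shows "stiefel_gamma b q x y \<bullet> z - b * ((transpose q ** stiefel_gamma b q x y) \<bullet> (transpose q ** z))
    = - b * ((transpose q ** y) \<bullet> (transpose x ** z) + (transpose q ** x) \<bullet> (transpose y ** z))"
proof -
  define A B C where "A = transpose q ** x" and "B = transpose q ** y" and "C = transpose q ** z"
  have skew: "transpose A = - A" "transpose B = - B" "transpose C = - C"
    using tangent_transpose(1)[OF x] tangent_transpose(1)[OF y] tangent_transpose(1)[OF z]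
    by (simp_all add: A_def B_def C_def matrix_transpose_mul)
  have 1: "(transpose q ** stiefel_gamma b q x y) \<bullet> (transpose q ** z) = 0"
    unfolding transpose_mult_stiefel_gamma[OF q] C_def[symmetric]
    by (rule inner_sym_skew[OF _ skew(3)]) (simp add: matrix_ring_simps add.commute)
  have 2: "(A ** B + B ** A) \<bullet> C = 0"
    by (rule inner_sym_skew[OF _ skew(3)]) (simp add: matrix_ring_simps add.commute skew)
  have 3: "(q ** (transpose x ** y + transpose y ** x)) \<bullet> z = 0"
    unfolding inner_matmul_left C_def[symmetric]
    by (rule inner_sym_skew[OF _ skew(3)]) (simp add: matrix_ring_simps add.commute)
  have 4: "(q ** (transpose q ** (x ** B + y ** A))) \<bullet> z = 0"
  proof -
    have "transpose q ** (x ** B + y ** A) = A ** B + B ** A"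
      by (simp add: A_def B_def matmul.add_right matrix_mul_assoc)
    then show ?thesis using 2 by (simp add: inner_matmul_left C_def)
  qed
  have "stiefel_gamma b q x y \<bullet> z = - b * ((x ** B + y ** A) \<bullet> z)"
    unfolding stiefel_gamma_def horizontal_def A_def[symmetric] B_def[symmetric]
    by (simp only: inner_diff_left inner_scaleR_left 3 4) simp
  then show ?thesis
    unfolding 1 A_def[symmetric] B_def[symmetric] by (simp add: inner_add_left inner_matmul_left)
qed

lemma riemannian_metric_stiefel:
  assumes a: "a0 > 0" "a1 > 0"
  shows "riemannian_metric (stiefel :: (real^'p::finite^'n::finite) set) (stiefel_metric a0 a1)"
  unfolding riemannian_metric_def
proof (intro conjI ballI allI impI)
  fix X Y :: "real^'p^'n \<Rightarrow> real^'p^'n"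
  assume X: "vector_field stiefel X" and Y: "vector_field stiefel Y"
  show "smooth_fun stiefel (\<lambda>q. stiefel_metric a0 a1 q (X q) (Y q))"
    unfolding smooth_fun_local_ext
  proof
    fix p :: "real^'p^'n" assume p: "p \<in> stiefel"
    obtain U X' Y' where U: "p \<in> U" "open U" "local_ext stiefel U X X'" "local_ext stiefel U Y Y'"
      by (rule common_ext[OF vector_field_local_ext[OF X p] vector_field_local_ext[OF Y p]], rule that)
    then have "local_ext stiefel U (\<lambda>q. stiefel_metric a0 a1 q (X q) (Y q))
      (\<lambda>q. a0 *\<^sub>R (X' q \<bullet> Y' q) + (a1 - a0) *\<^sub>R ((transpose q ** X' q) \<bullet> (transpose q ** Y' q)))"
      unfolding local_ext_def stiefel_metric_inner by (auto intro!: smooth_intros)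
    then show "\<exists>U F. p \<in> U \<and> local_ext stiefel U (\<lambda>q. stiefel_metric a0 a1 q (X q) (Y q)) F"
      using U(1) by blast
  qed
next
  fix p u :: "real^'p^'n" assume p: "p \<in> stiefel" and u: "u \<noteq> 0"
  \<comment> \<open>In the components \<open>A\<close> and \<open>H\<close> the metric is diagonal
    with weights \<open>a1\<close> and \<open>a0\<close>, which makes positivity visible.\<close>
  define A H where "A = transpose p ** u" and "H = horizontal p u"
  have uAH: "u = p ** A + H" by (simp add: A_def H_def horizontal_def)
  have pH: "transpose p ** H = 0" by (simp add: H_def horizontal_def matmul.diff_right stiefel_cancel[OF p])
  have "u \<bullet> u = A \<bullet> A + H \<bullet> H"
    using pH p unfolding uAH
    by (simp add: inner_add_left inner_add_right inner_matmul_left inner_commute[of H "p ** A"] stiefel_cancel)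
  moreover have "A \<noteq> 0 \<or> H \<noteq> 0" using u uAH by (auto simp: matmul.zero_right)
  then have "a1 * (A \<bullet> A) + a0 * (H \<bullet> H) > 0"
    using a by (metis add_nonneg_pos add_pos_nonneg inner_ge_zero inner_gt_zero_iff mult_nonneg_nonneg mult_pos_pos less_imp_le)
  ultimately show "stiefel_metric a0 a1 p u u > 0"
    by (simp add: stiefel_metric_inner A_def[symmetric] algebra_simps)
qed (auto simp: stiefel_metric_inner matmul.add_right matmul.scaleR_right inner_add_left inner_commute algebra_simps)

text \<open>The metric depends on the base point through \<open>transpose q\<close>, which adds two
  terms to its derivative. Their factor is \<open>a1 - a0 = - b * a0\<close>, and the two
  Christoffel contributions sum to just these terms.\<close>

lemma stiefel_compatible:
  fixes X Y Z :: "real^'p::finite^'n::finite \<Rightarrow> real^'p^'n"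
  assumes X: "vector_field stiefel X" and Y: "vector_field stiefel Y" and Z: "vector_field stiefel Z" and p: "p \<in> stiefel"
    and b: "a1 = (1 - b) * a0"
  shows "dir_deriv stiefel (\<lambda>q. stiefel_metric a0 a1 q (Y q) (Z q)) p (X p)
        = stiefel_metric a0 a1 p (dir_deriv stiefel Y p (X p) + stiefel_gamma b p (X p) (Y p)) (Z p)
        + stiefel_metric a0 a1 p (Y p) (dir_deriv stiefel Z p (X p) + stiefel_gamma b p (X p) (Z p))"
proof -
  have T: "X p \<in> tangent_space stiefel p" using vector_field_tangent[OF X p] .
  have t: "transpose p ** X p + transpose (X p) ** p = 0" "transpose p ** Y p + transpose (Y p) ** p = 0"
    "transpose p ** Z p + transpose (Z p) ** p = 0"
    using tangent_space_stiefel_imp vector_field_tangent X Y Z p by blast+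
  obtain U Y' Z' where U: "p \<in> U" "open U" "local_ext stiefel U Y Y'" "local_ext stiefel U Z Z'"
    by (rule common_ext[OF vector_field_local_ext[OF Y p] vector_field_local_ext[OF Z p]], rule that)
  have S: "smooth_on U Y'" "smooth_on U Z'" and eq: "Y' p = Y p" "Z' p = Z p"
    using U p unfolding local_ext_def by auto
  let ?F = "\<lambda>q. a0 *\<^sub>R (Y' q \<bullet> Z' q) + (a1 - a0) *\<^sub>R ((transpose q ** Y' q) \<bullet> (transpose q ** Z' q))"
  have ext: "local_ext stiefel U (\<lambda>q. stiefel_metric a0 a1 q (Y q) (Z q)) ?F"
    using U unfolding local_ext_def stiefel_metric_inner by (auto intro!: smooth_intros)
  let ?Y = "frechet_derivative Y' (at p)" and ?Z = "frechet_derivative Z' (at p)"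
  have "(?F has_derivative (\<lambda>u. a0 *\<^sub>R (Y' p \<bullet> ?Z u + ?Y u \<bullet> Z' p)
      + (a1 - a0) *\<^sub>R ((transpose p ** Y' p) \<bullet> (transpose p ** ?Z u + transpose u ** Z' p)
         + (transpose p ** ?Y u + transpose u ** Y' p) \<bullet> (transpose p ** Z' p)))) (at p)"
    by (intro has_derivative_add has_derivative_scaleR_right has_derivative_inner matmul.FDERIV has_derivative_transpose
        has_derivative_ident smooth_on_has_derivative[OF _ U(1)] S)
  note D = frechet_derivative_at[OF this, symmetric]
  let ?G = "stiefel_gamma b p (X p) (Y p)" and ?H = "stiefel_gamma b p (X p) (Z p)"
  have skew: "transpose (transpose p ** X p) = - (transpose p ** X p)"
    using tangent_transpose(1)[OF t(1)] by (simp add: matrix_transpose_mul)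
  \<comment> \<open>Transposition flips the skew factor, so the terms with
    \<open>transpose p ** X p\<close> from the two Christoffel contributions cancel.\<close>
  have "(transpose p ** X p) \<bullet> (transpose (Z p) ** Y p) = - ((transpose p ** X p) \<bullet> (transpose (Y p) ** Z p))"
    using inner_transpose[of "transpose p ** X p" "transpose (Y p) ** Z p"] skew by (simp add: matrix_transpose_mul)
  then have key: "?G \<bullet> Z p - b * ((transpose p ** ?G) \<bullet> (transpose p ** Z p))
     + (?H \<bullet> Y p - b * ((transpose p ** ?H) \<bullet> (transpose p ** Y p)))
     = - b * ((transpose p ** Y p) \<bullet> (transpose (X p) ** Z p) + (transpose p ** Z p) \<bullet> (transpose (X p) ** Y p))"
    unfolding metric_stiefel_gamma[OF p t(3,1,2)] metric_stiefel_gamma[OF p t(2,1,3)] by (simp add: algebra_simps)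
  have "dir_deriv stiefel (\<lambda>q. stiefel_metric a0 a1 q (Y q) (Z q)) p (X p)
     = a0 * (Y p \<bullet> ?Z (X p) + ?Y (X p) \<bullet> Z p)
      + (a1 - a0) * ((transpose p ** Y p) \<bullet> (transpose p ** ?Z (X p)) + (transpose p ** ?Y (X p)) \<bullet> (transpose p ** Z p))
      + a0 * (- b * ((transpose p ** Y p) \<bullet> (transpose (X p) ** Z p) + (transpose p ** Z p) \<bullet> (transpose (X p) ** Y p)))"
    using dir_deriv_eq[OF ext U(1) T] unfolding D
    by (simp add: eq b inner_add_left inner_add_right inner_commute algebra_simps)
  then show ?thesis
    unfolding key[symmetric] dir_deriv_eq[OF U(3,1) T] dir_deriv_eq[OF U(4,1) T] stiefel_metric_inner
    by (simp add: b inner_add_left inner_add_right matmul.add_right inner_commute algebra_simps)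
qed

lemma christoffel_stiefel:
  assumes a: "a0 > 0" "a1 > 0" and b: "a1 = (1 - b) * a0"
  shows "christoffel (stiefel :: (real^'p::finite^'n::finite) set) (stiefel_metric a0 a1)
    (stiefel_gamma b) (stiefel_dgamma b)"
proof
  show "riemannian_metric (stiefel :: (real^'p^'n) set) (stiefel_metric a0 a1)"
    using riemannian_metric_stiefel[OF a] .
  show "subspace (tangent_space stiefel p)" if "p \<in> stiefel" for p :: "real^'p^'n"
    unfolding tangent_space_stiefel[OF that]
    by (intro linear_subspace_kernel linearI) (simp_all add: matrix_ring_simps)
  show "\<exists>X. vector_field stiefel X \<and> X p = v" if "p \<in> stiefel" "v \<in> tangent_space stiefel p" for p v :: "real^'p^'n"
    using stiefel_extend that tangent_space_stiefel_imp by blast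
  show "dir_deriv stiefel Y p (X p) + stiefel_gamma b p (X p) (Y p) \<in> tangent_space stiefel p"
    if "vector_field stiefel X" "vector_field stiefel Y" "p \<in> stiefel" for X Y and p :: "real^'p^'n"
  proof -
    \<comment> \<open>This is the negative of the defect found in
      \<open>vector_field_stiefel_deriv\<close>.\<close>
    have G: "transpose p ** stiefel_gamma b p (X p) (Y p) + transpose (stiefel_gamma b p (X p) (Y p)) ** p
      = transpose (X p) ** Y p + transpose (Y p) ** X p"
    proof -
      have "transpose (stiefel_gamma b p (X p) (Y p)) ** p = transpose (transpose p ** stiefel_gamma b p (X p) (Y p))"
        by (simp add: matrix_transpose_mul)
      then show ?thesis
        unfolding transpose_mult_stiefel_gamma[OF that(3)]
        by (simp add: matrix_ring_simps)
    qed
    have split: "transpose p ** (D + E) + transpose (D + E) ** p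
      = (transpose p ** D + transpose D ** p) + (transpose p ** E + transpose E ** p)" for D E :: "real^'p^'n"
      by (simp add: matrix_ring_simps algebra_simps)
    show ?thesis
      unfolding tangent_space_stiefel[OF that(3)] mem_Collect_eq split G
        vector_field_stiefel_deriv[OF that(2,3) vector_field_tangent[OF that(1,3)]]
      by simp
  qed
qed (rule bilinear_stiefel_gamma stiefel_gamma_sym smooth_on_stiefel_gamma has_derivative_stiefel_gamma
    stiefel_compatible[OF _ _ _ _ b]; assumption)+

section \<open>The Ricci tensor of the Stiefel manifold\<close>

text \<open>Repeats \<open>riem\<close> of the locale outside it, so that the matrix identities need
  no assumptions on the metric.\<close>

definition stiefel_riem ::
    "real \<Rightarrow> real^'p::finite^'n::finite \<Rightarrow> real^'p^'n \<Rightarrow> real^'p^'n \<Rightarrow> real^'p^'n \<Rightarrow> real^'p^'n" where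
  "stiefel_riem b q u v w = stiefel_dgamma b q u v w - stiefel_dgamma b q v u w
     + stiefel_gamma b q u (stiefel_gamma b q v w) - stiefel_gamma b q v (stiefel_gamma b q u w)"

section \<open>Traces of linear maps on matrix spaces\<close>

definition endo_trace :: "('a::euclidean_space \<Rightarrow> 'a) \<Rightarrow> real" where
  "endo_trace f = (\<Sum>e\<in>Basis. e \<bullet> f e)"

lemma endo_trace_add: "endo_trace (\<lambda>x. f x + g x) = endo_trace f + endo_trace g"
  and endo_trace_diff: "endo_trace (\<lambda>x. f x - g x) = endo_trace f - endo_trace g"
  and endo_trace_scaleR: "endo_trace (\<lambda>x. c *\<^sub>R f x) = c * endo_trace f"
  by (simp_all add: endo_trace_def inner_add_right inner_diff_right sum.distrib sum_subtractf sum_distrib_left)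

text \<open>The two spaces may differ, so a trace over tall matrices can be moved to one over square
  matrices.\<close>

lemma endo_trace_comm:
  fixes f :: "'a::euclidean_space \<Rightarrow> 'b::euclidean_space"
  assumes "linear f" "linear g"
  shows "endo_trace (\<lambda>x. g (f x)) = endo_trace (\<lambda>y. f (g y))"
proof -
  have "endo_trace (\<lambda>x. g (f x)) = (\<Sum>e\<in>Basis. \<Sum>d\<in>Basis. (f e \<bullet> d) * (e \<bullet> g d))"
    unfolding endo_trace_def
    by (subst euclidean_representation[of "f _", symmetric])
      (simp add: linear_sum[OF assms(2)] linear_cmul[OF assms(2)] inner_sum_right)
  also have "\<dots> = (\<Sum>d\<in>Basis. \<Sum>e\<in>Basis. (g d \<bullet> e) * (d \<bullet> f e))"
    by (subst sum.swap) (simp add: inner_commute mult.commute)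
  also have "\<dots> = endo_trace (\<lambda>y. f (g y))"
    unfolding endo_trace_def
    by (subst euclidean_representation[of "g _", symmetric])
      (simp add: linear_sum[OF assms(1)] linear_cmul[OF assms(1)] inner_sum_right)
  finally show ?thesis .
qed

lemma sum_Basis_matrix:
  "(\<Sum>e\<in>Basis. f (e :: real^'p::finite^'n::finite)) = (\<Sum>i\<in>UNIV. \<Sum>j\<in>UNIV. f (axis i (axis j 1)))"
proof -
  have inj: "inj_on (\<lambda>(i, j). axis i (axis j 1) :: real^'p^'n) UNIV"
    by (auto simp: inj_on_def axis_eq_axis)
  have eq: "(Basis :: (real^'p^'n) set) = (\<lambda>(i, j). axis i (axis j 1)) ` UNIV"
    by (auto simp: Basis_vec_def image_iff)
  have "(\<Sum>e\<in>Basis. f (e :: real^'p^'n)) = (\<Sum>(i, j)\<in>UNIV. f (axis i (axis j 1)))"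
    unfolding eq by (subst sum.reindex[OF inj]) (simp add: split_def)
  then show ?thesis by (simp add: sum.cartesian_product)
qed

lemma axis_matrix_inner: "axis i (axis j 1) \<bullet> M = M $ i $ j" for M :: "real^'p::finite^'n::finite"
  by (simp add: inner_axis' )

lemma trace_inner: "trace M = M \<bullet> (mat 1 :: real^'p::finite^'p)"
  using trace_transpose_mult[of "mat 1" M] by (simp add: inner_commute)

lemma endo_trace_mult:
  "endo_trace (\<lambda>x :: real^'p::finite^'n::finite. A ** (x ** B)) = trace A * trace B"
proof -
  have "endo_trace (\<lambda>x :: real^'p^'n. A ** (x ** B)) = (\<Sum>i\<in>UNIV. \<Sum>j\<in>UNIV. A $ i $ i * B $ j $ j)"
    unfolding endo_trace_def sum_Basis_matrix axis_matrix_inner axis_matmul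
    by (simp add: matrix_matrix_mult_def axis_def if_distrib[of "\<lambda>x. _ * x"] if_distrib[of "\<lambda>x. x $ _"] cong: if_cong)
  then show ?thesis by (simp add: trace_def sum_product)
qed

text \<open>The matrix unit in row \<open>i\<close> and column \<open>j\<close> contributes
  \<open>A $ i $ j * B $ i $ j\<close>, whence an inner product instead of a product of
  traces.\<close>

lemma endo_trace_mult_transpose:
  "endo_trace (\<lambda>x :: real^'p::finite^'n::finite. A ** (transpose x ** B)) = A \<bullet> B"
  unfolding endo_trace_def sum_Basis_matrix axis_matrix_inner transpose_axis axis_matmul
  by (simp add: inner_vec_def matrix_matrix_mult_def axis_def if_distrib[of "\<lambda>x. _ * x"] if_distrib[of "\<lambda>x. x $ _"] cong: if_cong)

lemma endo_trace_mult_skew: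
  "endo_trace (\<lambda>x :: real^'p::finite^'p. A ** (((1/2) *\<^sub>R (x - transpose x)) ** B)) = (trace A * trace B - A \<bullet> B) / 2"
proof -
  have "(\<lambda>x :: real^'p^'p. A ** (((1/2) *\<^sub>R (x - transpose x)) ** B))
    = (\<lambda>x. (1/2) *\<^sub>R (A ** (x ** B) - A ** (transpose x ** B)))"
    by (simp add: matrix_ring_simps)
  then show ?thesis
    by (simp add: endo_trace_scaleR endo_trace_diff endo_trace_mult endo_trace_mult_transpose)
qed

lemma horizontal_cancel:
  assumes "transpose q ** H = (0 :: real^'p::finite^'p)"
  shows "transpose q ** (H ** z) = 0" and "transpose H ** q = 0" and "transpose H ** (q ** y) = 0"
proof -
  show "transpose q ** (H ** z) = 0" using assms by (simp add: matrix_mul_assoc matmul.zero_left)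
  show *: "transpose H ** q = 0"
    using arg_cong[OF assms, of transpose] by (simp add: matrix_transpose_mul transpose_zero)
  show "transpose H ** (q ** y) = 0" using * by (simp add: matrix_mul_assoc matmul.zero_left)
qed

text \<open>
  Tangent vectors at \<open>q\<close> are written \<open>q ** A + H\<close> with \<open>A\<close> skew and \<open>H\<close> orthogonal to the columns of \<open>q\<close>.
  The next two lemmas hold for arbitrary \<open>A\<close>, \<open>B\<close>, \<open>C\<close>, which is needed because the values
  of the Christoffel map are not tangent: their \<open>q\<close>-component is symmetric.
\<close>

lemma stiefel_gamma_split:
  assumes q: "q \<in> stiefel" and H: "transpose q ** H = 0" and K: "transpose q ** K = 0"
  shows "stiefel_gamma b q (q ** A + H) (q ** B + K)
    = q ** ((1/2) *\<^sub>R (transpose A ** B + transpose B ** A + transpose H ** K + transpose K ** H))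
      - b *\<^sub>R (H ** B + K ** A)"
  unfolding stiefel_gamma_def horizontal_def
  by (simp add: matrix_ring_simps stiefel_cancel[OF q] H K horizontal_cancel[OF H] horizontal_cancel[OF K])

lemma stiefel_dgamma_split:
  assumes q: "q \<in> stiefel" and H: "transpose q ** H = 0" and K: "transpose q ** K = 0" and U: "transpose q ** U = 0"
  shows "stiefel_dgamma b q (q ** C + U) (q ** A + H) (q ** B + K)
    = (1/2) *\<^sub>R ((q ** C + U) ** (transpose A ** B + transpose B ** A + transpose H ** K + transpose K ** H))
      + b *\<^sub>R ((q ** C + U) ** (A ** B + B ** A)
          + q ** (transpose C ** (A ** B + B ** A) + transpose U ** (H ** B + K ** A)))
      - b *\<^sub>R (H ** (transpose C ** B + transpose U ** K) + K ** (transpose C ** A + transpose U ** H))"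
  unfolding stiefel_dgamma_def horizontal_def
  by (simp add: matrix_ring_simps stiefel_cancel[OF q] H K U horizontal_cancel[OF H] horizontal_cancel[OF K]
       horizontal_cancel[OF U])

text \<open>Only the diagonal blocks of the curvature operator enter its trace: the horizontal part
  of the image of a horizontal \<open>U\<close> and the vertical part of the image of a vertical
  \<open>q ** C\<close>. \<open>S\<close> is the component along \<open>q\<close> of the Christoffel
  value of the two fixed vectors.\<close>

lemma
  fixes q H K U :: "real^'p::finite^'n::finite"
  assumes q: "q \<in> stiefel" and H: "transpose q ** H = 0" and K: "transpose q ** K = 0"
    and A: "transpose A = - A" and B: "transpose B = - B"
  defines "S \<equiv> (1/2) *\<^sub>R (transpose H ** K + transpose K ** H - A ** B - B ** A)"
  shows horizontal_stiefel_riem: "transpose q ** U = 0 \<Longrightarrow>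
    horizontal q (stiefel_riem b q U (q ** A + H) (q ** B + K))
      = U ** ((1 - b) *\<^sub>R S + (b - b * b) *\<^sub>R (B ** A) + b *\<^sub>R (transpose H ** K))
        - b *\<^sub>R (H ** (transpose U ** K)) - b *\<^sub>R (K ** (transpose U ** H)) + b *\<^sub>R (K ** (transpose H ** U))
        - ((1 - b) / 2) *\<^sub>R (H ** (transpose U ** K) + H ** (transpose K ** U))"
    and vertical_stiefel_riem: "transpose C = - C \<Longrightarrow>
    transpose q ** (stiefel_riem b q (q ** C) (q ** A + H) (q ** B + K))
      = (1/2) *\<^sub>R (S ** C + C ** S)
        + (1/4) *\<^sub>R (A ** (C ** B) + A ** (B ** C) + C ** (B ** A) + B ** (C ** A))
        - (b/2) *\<^sub>R (transpose H ** (K ** C) + C ** (transpose K ** H))"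
proof -
  note hc = horizontal_cancel[OF H] horizontal_cancel[OF K]
  \<comment> \<open>Again of the form \<open>q ** S\<close> plus a horizontal matrix, so the
    splitting lemma also applies to the nested Christoffel values.\<close>
  have Gvw: "stiefel_gamma b q (q ** A + H) (q ** B + K) = q ** S + (- b) *\<^sub>R (H ** B + K ** A)"
    unfolding stiefel_gamma_split[OF q H K] S_def by (simp add: A B matrix_ring_simps)
  have hG: "transpose q ** ((- b) *\<^sub>R (H ** B + K ** A)) = 0"
    by (simp add: matrix_ring_simps hc)
  {
    assume U: "transpose q ** U = 0"
    note hU = horizontal_cancel[OF U]
    have Guw: "stiefel_gamma b q (q ** 0 + U) (q ** B + K)
      = q ** ((1/2) *\<^sub>R (transpose U ** K + transpose K ** U)) + (- b) *\<^sub>R (U ** B)"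
      unfolding stiefel_gamma_split[OF q U K] by (simp add: matrix_ring_simps)
    have hUB: "transpose q ** ((- b) *\<^sub>R (U ** B)) = 0" by (simp add: matrix_ring_simps hU)
    have "stiefel_riem b q U (q ** A + H) (q ** B + K) = stiefel_riem b q (q ** 0 + U) (q ** A + H) (q ** B + K)"
      by (simp add: matmul.zero_right)
    also have "horizontal q \<dots>
      = U ** ((1 - b) *\<^sub>R S + (b - b * b) *\<^sub>R (B ** A) + b *\<^sub>R (transpose H ** K))
        - b *\<^sub>R (H ** (transpose U ** K)) - b *\<^sub>R (K ** (transpose U ** H)) + b *\<^sub>R (K ** (transpose H ** U))
        - ((1 - b) / 2) *\<^sub>R (H ** (transpose U ** K) + H ** (transpose K ** U))"
      unfolding stiefel_riem_def Gvw Guw stiefel_gamma_split[OF q U hG] stiefel_gamma_split[OF q H hUB]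
        stiefel_dgamma_split[OF q H K U] stiefel_dgamma_split[OF q U K H] horizontal_def S_def
      by (simp add: matrix_ring_simps stiefel_cancel[OF q] H K U hc hU A B) (simp add: vec_eq_iff field_simps)
    finally show "horizontal q (stiefel_riem b q U (q ** A + H) (q ** B + K))
      = U ** ((1 - b) *\<^sub>R S + (b - b * b) *\<^sub>R (B ** A) + b *\<^sub>R (transpose H ** K))
        - b *\<^sub>R (H ** (transpose U ** K)) - b *\<^sub>R (K ** (transpose U ** H)) + b *\<^sub>R (K ** (transpose H ** U))
        - ((1 - b) / 2) *\<^sub>R (H ** (transpose U ** K) + H ** (transpose K ** U))" .
  next
    assume C: "transpose C = - C"
    have U: "transpose q ** (0 :: real^'p^'n) = 0" by (simp add: matmul.zero_right)
    have Guw: "stiefel_gamma b q (q ** C + 0) (q ** B + K)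
      = q ** ((- 1/2) *\<^sub>R (C ** B + B ** C)) + (- b) *\<^sub>R (K ** C)"
      unfolding stiefel_gamma_split[OF q U K] by (simp add: matrix_ring_simps B C)
    have hKC: "transpose q ** ((- b) *\<^sub>R (K ** C)) = 0" by (simp add: matrix_ring_simps hc)
    have "stiefel_riem b q (q ** C) (q ** A + H) (q ** B + K) = stiefel_riem b q (q ** C + 0) (q ** A + H) (q ** B + K)"
      by simp
    also have "transpose q ** \<dots>
      = (1/2) *\<^sub>R (S ** C + C ** S)
        + (1/4) *\<^sub>R (A ** (C ** B) + A ** (B ** C) + C ** (B ** A) + B ** (C ** A))
        - (b/2) *\<^sub>R (transpose H ** (K ** C) + C ** (transpose K ** H))"
      unfolding stiefel_riem_def Gvw Guw stiefel_gamma_split[OF q U hG] stiefel_gamma_split[OF q H hKC]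
        stiefel_dgamma_split[OF q H K U] stiefel_dgamma_split[OF q U K H] S_def
      by (simp add: matrix_ring_simps stiefel_cancel[OF q] H K U hc A B C) (simp add: vec_eq_iff field_simps)
    finally show "transpose q ** (stiefel_riem b q (q ** C) (q ** A + H) (q ** B + K))
      = (1/2) *\<^sub>R (S ** C + C ** S)
        + (1/4) *\<^sub>R (A ** (C ** B) + A ** (B ** C) + C ** (B ** A) + B ** (C ** A))
        - (b/2) *\<^sub>R (transpose H ** (K ** C) + C ** (transpose K ** H))" .
  }
qed

lemma linear_stiefel_riem: "linear (\<lambda>u. stiefel_riem b q u v w)"
proof -
  have "linear (\<lambda>u. stiefel_dgamma b q u v w)" "linear (\<lambda>u. stiefel_dgamma b q v u w)"
    unfolding stiefel_dgamma_def horizontal_def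
    by (auto intro!: linearI simp: matrix_ring_simps) (simp_all add: vec_eq_iff algebra_simps)
  moreover have "linear (\<lambda>u. stiefel_gamma b q u z)" "linear (\<lambda>u. stiefel_gamma b q v (stiefel_gamma b q u w))" for z
    using bilinear_stiefel_gamma[of b q] by (auto intro!: linearI simp: bilinear_ladd bilinear_radd bilinear_lmul bilinear_rmul)
  ultimately show ?thesis
    unfolding stiefel_riem_def by (intro linear_compose_add linear_compose_sub)
qed

lemma ricci_stiefel:
  fixes q H K :: "real^'p::finite^'n::finite" and \<alpha> :: real
  assumes a: "a0 > 0" "a1 > 0" and \<alpha>: "\<alpha> = a1 / a0"
    and q: "q \<in> stiefel" and H: "transpose q ** H = 0" and K: "transpose q ** K = 0"
    and A: "transpose A = - A" and B: "transpose B = - B"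
  shows "ricci stiefel (stiefel_metric a0 a1) q (q ** A + H) (q ** B + K)
    = (real CARD('n) - 2 - (real CARD('p) - 1) * \<alpha>) * (H \<bullet> K)
      + ((real CARD('p) - 2) / 4 + (real CARD('n) - CARD('p)) * \<alpha>\<^sup>2) * (A \<bullet> B)"
proof -
  define b where "b = 1 - \<alpha>"
  have b: "a1 = (1 - b) * a0" using a by (simp add: b_def \<alpha>)
  interpret christoffel "stiefel :: (real^'p^'n) set" "stiefel_metric a0 a1" "stiefel_gamma b" "stiefel_dgamma b"
    by (rule christoffel_stiefel[OF a b])
  let ?T = "tangent_space stiefel q"
  have T: "?T = {v. transpose q ** v + transpose v ** q = 0}" by (rule tangent_space_stiefel[OF q])
  define v w where "v = q ** A + H" and "w = q ** B + K"
  note hc = horizontal_cancel[OF H] horizontal_cancel[OF K]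
  have vw: "v \<in> ?T" "w \<in> ?T"
    unfolding T v_def w_def using q by (simp_all add: matrix_ring_simps stiefel_cancel[OF q] stiefel_iff H K A B hc)
  define L where "L = (\<lambda>u. stiefel_riem b q u v w)"
  have linL: "linear L" unfolding L_def by (rule linear_stiefel_riem)
  have riem: "riem q u v w = L u" for u by (simp add: L_def riem_def stiefel_riem_def)
  \<comment> \<open>\<open>Pv\<close> keeps the skew part of \<open>transpose q ** x\<close>; adding
    the horizontal projection gives a projection onto the tangent space.\<close>
  define Pv where "Pv = (\<lambda>x. q ** ((1/2) *\<^sub>R (transpose q ** x - transpose (transpose q ** x))))"
  define P where "P = (\<lambda>x. horizontal q x + Pv x)"
  have lin: "linear (horizontal q)" "linear Pv" "linear ((**) (transpose q) :: real^'p^'n \<Rightarrow> real^'p^'p)"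
    unfolding horizontal_def Pv_def
    by (auto intro!: linearI simp: matrix_ring_simps)
  have linP: "linear P" unfolding P_def by (intro linear_compose_add lin)
  have PT: "P x \<in> ?T" for x
    unfolding T P_def Pv_def horizontal_def using q
    by (simp add: matrix_ring_simps stiefel_cancel[OF q] stiefel_iff)
  have Pid: "P x = x" if "x \<in> ?T" for x
    using that tangent_transpose(1)[of q x] unfolding T P_def Pv_def horizontal_def
    by (simp add: matrix_ring_simps flip: scaleR_2)
  have "ricci stiefel (stiefel_metric a0 a1) q v w = endo_trace (\<lambda>x. L (P x))"
    unfolding ricci_def endo_trace_def
  proof (rule trace_on_eq[OF subspace_tangent[OF q] linL _ _ linP PT Pid])
    show "L x \<in> ?T" "curvature_at stiefel (stiefel_metric a0 a1) q x v w = L x" if "x \<in> ?T" for x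
      using riem_tangent[OF q that vw] curvature_at_eq[OF q that vw] by (simp_all add: riem)
  qed
  also have "\<dots> = endo_trace (\<lambda>x. L (horizontal q x)) + endo_trace (\<lambda>x. L (Pv x))"
    by (simp add: P_def linear_add[OF linL] flip: endo_trace_add)
  finally have split: "ricci stiefel (stiefel_metric a0 a1) q v w
    = endo_trace (\<lambda>x. L (horizontal q x)) + endo_trace (\<lambda>x. L (Pv x))" .

  have pos: "trace (mat 1 :: real^'p^'p) = CARD('p)" "trace (mat 1 :: real^'n^'n) = CARD('n)"
    by (simp_all add: trace_I)
  have tr0: "A \<bullet> mat 1 = 0" "B \<bullet> mat 1 = 0"
    using inner_sym_skew[of "mat 1" A] inner_sym_skew[of "mat 1" B] A B by (simp_all add: inner_commute)
  have trAB: "(A ** B) \<bullet> mat 1 = - (A \<bullet> B)" "(B ** A) \<bullet> mat 1 = - (A \<bullet> B)"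
    by (simp_all add: inner_matmul_left A B inner_commute[of B A])
  have trHK: "(transpose H ** K) \<bullet> mat 1 = H \<bullet> K" "(transpose K ** H) \<bullet> mat 1 = H \<bullet> K"
    unfolding trace_inner[symmetric] trace_transpose_mult by (simp_all add: inner_commute)
  have trKH: "trace (K ** transpose H) = H \<bullet> K" "trace (H ** transpose K) = H \<bullet> K"
    by (subst trace_mul_sym, simp add: trace_transpose_mult inner_commute)+
  have trqq: "trace (q ** transpose q) = CARD('p)"
    using q by (subst trace_mul_sym) (simp add: stiefel_iff trace_I)
  define S where "S = (1/2) *\<^sub>R (transpose H ** K + transpose K ** H - A ** B - B ** A)"
  have trS: "S \<bullet> mat 1 = H \<bullet> K + A \<bullet> B"
    unfolding S_def by (simp add: inner_diff_left inner_add_left trAB trHK)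

  have Pv: "endo_trace (\<lambda>x. L (Pv x))
    = (real CARD('p) - 1) / 2 * (1 - b) * (H \<bullet> K) + (real CARD('p) - 2) / 4 * (A \<bullet> B)"
  proof -
    let ?s = "\<lambda>x :: real^'p^'p. (1/2) *\<^sub>R (x - transpose x)"
    have linq: "linear (\<lambda>x. L (q ** ?s x))"
      by (intro linear_compose[OF _ linL, unfolded o_def] linearI) (simp_all add: matrix_ring_simps algebra_simps)
    have skew: "transpose (?s x) = - ?s x" for x
      by (simp add: matrix_ring_simps)
    \<comment> \<open>Cyclicity moves the trace to square matrices, where only the vertical part of
      the image is seen.\<close>
    have "endo_trace (\<lambda>x. L (Pv x)) = endo_trace (\<lambda>x. transpose q ** L (q ** ?s x))"
      unfolding Pv_def by (rule endo_trace_comm[OF lin(3) linq])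
    also have "\<dots> = endo_trace (\<lambda>x. (1/2) *\<^sub>R (S ** (?s x ** mat 1) + mat 1 ** (?s x ** S))
        + (1/4) *\<^sub>R (A ** (?s x ** B) + (A ** B) ** (?s x ** mat 1) + mat 1 ** (?s x ** (B ** A)) + B ** (?s x ** A))
        - (b/2) *\<^sub>R ((transpose H ** K) ** (?s x ** mat 1) + mat 1 ** (?s x ** (transpose K ** H))))"
      unfolding L_def v_def w_def vertical_stiefel_riem[OF q H K A B skew] S_def[symmetric]
      by (simp only: matrix_mul_lid matrix_mul_rid matrix_mul_assoc)
    \<comment> \<open>\<open>A\<close> and \<open>B\<close> have trace zero, so a term with
      \<open>A\<close> on one side and \<open>B\<close> on the other leaves
      \<open>- (A \<bullet> B) / 2\<close>. Where one side is \<open>mat 1\<close>, the result is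
      \<open>(CARD('p) - 1) / 2\<close> times the trace of the other.\<close>
    also have "\<dots> = (1/2) * ((real CARD('p) - 1) * (S \<bullet> mat 1))
        + (1/4) * (- (A \<bullet> B) - (real CARD('p) - 1) * (A \<bullet> B)) - (b/2) * ((real CARD('p) - 1) * (H \<bullet> K))"
      unfolding endo_trace_add endo_trace_diff endo_trace_scaleR endo_trace_mult_skew pos
      unfolding trace_inner inner_commute[of "mat 1"] trAB trHK tr0 inner_commute[of B A]
      by (simp add: field_simps)
    also have "\<dots> = (real CARD('p) - 1) / 2 * (1 - b) * (H \<bullet> K) + (real CARD('p) - 2) / 4 * (A \<bullet> B)"
      unfolding trS by (simp add: field_simps)
    finally show ?thesis .
  qed

  have Ph: "endo_trace (\<lambda>x. L (horizontal q x))
    = (real CARD('n) - CARD('p)) * ((1 - b) * (S \<bullet> mat 1) - (b - b * b) * (A \<bullet> B) + b * (H \<bullet> K))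
      + (b * CARD('p) - 2 * b - (1 - b) / 2 * (1 + CARD('p))) * (H \<bullet> K)"
  proof -
    let ?h = "horizontal q"
    define C where "C = (1 - b) *\<^sub>R S + (b - b * b) *\<^sub>R (B ** A) + b *\<^sub>R (transpose H ** K)"
    have hh: "?h (?h x) = ?h x" for x
      unfolding horizontal_def by (simp add: matrix_ring_simps stiefel_cancel[OF q])
    have qh: "transpose q ** ?h x = 0" for x
      unfolding horizontal_def by (simp add: matrix_ring_simps stiefel_cancel[OF q])
    have hx: "transpose (?h x) ** K = transpose x ** K" "transpose (?h x) ** H = transpose x ** H"
      "transpose H ** ?h x = transpose H ** x" "transpose K ** ?h x = transpose K ** x" for x
      unfolding horizontal_def using H K by (simp_all add: matrix_ring_simps hc)
    \<comment> \<open>The projection is idempotent, so cyclicity can put one copy in front of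
      \<open>L\<close>; only the horizontal part of the image remains.\<close>
    have "endo_trace (\<lambda>x. L (?h x)) = endo_trace (\<lambda>x. L (?h (?h x)))"
      by (simp add: hh)
    also have "\<dots> = endo_trace (\<lambda>x. ?h (L (?h x)))"
      by (rule endo_trace_comm[OF lin(1) linear_compose[OF lin(1) linL, unfolded o_def]])
    also have "\<dots> = endo_trace (\<lambda>x. mat 1 ** (x ** C) - (q ** transpose q) ** (x ** C)
        - b *\<^sub>R (H ** (transpose x ** K)) - b *\<^sub>R (K ** (transpose x ** H)) + b *\<^sub>R ((K ** transpose H) ** (x ** mat 1))
        - ((1 - b) / 2) *\<^sub>R (H ** (transpose x ** K) + (H ** transpose K) ** (x ** mat 1)))"
      unfolding L_def v_def w_def horizontal_stiefel_riem[OF q H K A B qh] S_def[symmetric] C_def[symmetric] hx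
      by (simp add: horizontal_def matmul.diff_left matrix_mul_assoc)
    \<comment> \<open>The factor \<open>CARD('n) - CARD('p)\<close> is the trace of
      \<open>mat 1 - q ** transpose q\<close>.\<close>
    also have "\<dots> = (real CARD('n) - CARD('p)) * trace C
      + (b * CARD('p) - 2 * b - (1 - b) / 2 * (1 + CARD('p))) * (H \<bullet> K)"
      unfolding endo_trace_add endo_trace_diff endo_trace_scaleR endo_trace_mult endo_trace_mult_transpose pos trKH trqq
        inner_commute[of K H]
      by (simp add: field_simps)
    also have "trace C = (1 - b) * (S \<bullet> mat 1) - (b - b * b) * (A \<bullet> B) + b * (H \<bullet> K)"
      unfolding C_def trace_inner by (simp add: inner_add_left trAB trHK)
    finally show ?thesis .
  qed
  show ?thesis
    unfolding split[unfolded v_def w_def] Ph Pv trS b_def by (simp add: field_simps power2_eq_square)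
qed

section \<open>The Einstein condition\<close>

text \<open>The columns of \<open>q\<close> are distinct coordinate vectors. A row outside the range
  of \<open>f\<close>, available since there are fewer columns than rows, carries \<open>H\<close>;
  two distinct columns give \<open>A\<close>.\<close>

lemma stiefel_witness:
  assumes "1 < CARD('p::finite)" and "CARD('p) < CARD('n::finite)"
  obtains q :: "real^'p^'n" and H :: "real^'p^'n" and A :: "real^'p^'p"
  where "q \<in> stiefel" "transpose q ** H = 0" "H \<noteq> 0" "transpose A = - A" "A \<noteq> 0"
proof -
  obtain f :: "'p \<Rightarrow> 'n" where f: "inj f"
    using inj_on_iff_card_le[of "UNIV :: 'p set" "UNIV :: 'n set"] assms by auto
  have "card (range f) < CARD('n)" using f assms by (simp add: card_image)
  then have "range f \<noteq> UNIV" by auto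
  then obtain i where i: "i \<notin> range f" by blast
  have "card {j :: 'p} < CARD('p)" for j using assms by simp
  then have "{j :: 'p} \<noteq> UNIV" for j by (metis less_irrefl)
  then obtain j k :: 'p where jk: "j \<noteq> k" by blast
  define q :: "real^'p^'n" where "q = (\<chi> i j. if i = f j then 1 else 0)"
  have "transpose q ** q = mat 1"
    using f by (simp add: q_def vec_eq_iff transpose_def matrix_matrix_mult_def mat_def inj_eq
        if_distrib[of "\<lambda>x. x * _"] cong: if_cong)
  moreover have "transpose q ** axis i (axis j 1) = 0"
    using i by (auto simp: q_def vec_eq_iff transpose_def matrix_matrix_mult_def axis_def intro!: sum.neutral)
  moreover have "axis i (axis j 1) \<noteq> (0 :: real^'p^'n)"
    by (simp add: axis_eq_0_iff)
  moreover have "transpose (axis j (axis k 1) - axis k (axis j 1)) = - (axis j (axis k 1) - axis k (axis j 1) :: real^'p^'p)"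
    by (simp add: transpose_diff transpose_axis)
  moreover have "axis j (axis k 1) - axis k (axis j 1) \<noteq> (0 :: real^'p^'p)"
    using jk by (simp add: axis_eq_axis)
  ultimately show thesis by (intro that[of q]) (simp_all only: stiefel_iff)
qed

lemma tangent_decompose:
  assumes q: "q \<in> stiefel" and v: "v \<in> tangent_space stiefel q"
  obtains A H where "v = q ** A + H" "transpose q ** H = 0" "transpose A = - A"
proof
  show "v = q ** (transpose q ** v) + horizontal q v" by (simp add: horizontal_def)
  show "transpose q ** horizontal q v = 0"
    by (simp add: horizontal_def matmul.diff_right stiefel_cancel[OF q])
  show "transpose (transpose q ** v) = - (transpose q ** v)"
    using tangent_transpose(1)[OF tangent_space_stiefel_imp[OF v]] by (simp add: matrix_transpose_mul)
qed

lemma stiefel_metric_split: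
  assumes q: "q \<in> stiefel" and H: "transpose q ** H = 0" and K: "transpose q ** K = 0"
  shows "stiefel_metric a0 a1 q (q ** A + H) (q ** B + K) = a0 * (H \<bullet> K) + a1 * (A \<bullet> B)"
proof -
  have "(q ** A + H) \<bullet> (q ** B + K) = A \<bullet> B + H \<bullet> K"
    using H K inner_commute[of H "q ** B"]
    by (simp add: inner_add_left inner_add_right inner_matmul_left stiefel_cancel[OF q])
  then show ?thesis
    by (simp add: stiefel_metric_inner matmul.add_right stiefel_cancel[OF q] H K algebra_simps)
qed

text \<open>Testing on one nonzero horizontal and one nonzero vertical vector gives two equations
  for the Einstein constant; eliminating it leaves the quadratic condition. Conversely the
  horizontal coefficient dictates the constant and the condition settles the vertical one, as
  neither tensor has mixed terms.\<close>

lemma einstein_stiefel_iff: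
  assumes card: "1 < CARD('p::finite)" "CARD('p) < CARD('n::finite)"
    and a: "a0 > 0" "a1 > 0" and \<alpha>: "\<alpha> = a1 / a0"
  shows "einstein_manifold (stiefel :: (real^'p^'n) set) (stiefel_metric a0 a1)
    \<longleftrightarrow> (real CARD('n) - 1) * \<alpha>\<^sup>2 - (real CARD('n) - 2) * \<alpha> + (real CARD('p) - 2) / 4 = 0"
    (is "?E \<longleftrightarrow> ?eq")
proof -
  let ?h = "real CARD('n) - 2 - (real CARD('p) - 1) * \<alpha>"
  let ?v = "(real CARD('p) - 2) / 4 + (real CARD('n) - CARD('p)) * \<alpha>\<^sup>2"
  let ?M = "stiefel :: (real^'p^'n) set"
  have a1: "a1 = \<alpha> * a0" using a \<alpha> by simp
  have "riemannian_manifold ?M (stiefel_metric a0 a1)"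
    unfolding riemannian_manifold_def
    using smooth_submanifold_stiefel riemannian_metric_stiefel[OF a] by blast
  then have E: "?E \<longleftrightarrow> (\<exists>c. \<forall>q\<in>?M. \<forall>v\<in>tangent_space ?M q. \<forall>w\<in>tangent_space ?M q.
      ricci ?M (stiefel_metric a0 a1) q v w = c * stiefel_metric a0 a1 q v w)"
    by (simp add: einstein_manifold_def)
  \<comment> \<open>The coefficients \<open>CARD('n) - CARD('p)\<close> and
    \<open>CARD('p) - 1\<close> add up to \<open>CARD('n) - 1\<close>.\<close>
  have eq: "?eq \<longleftrightarrow> ?v = \<alpha> * ?h"
    by (simp add: algebra_simps power2_eq_square)
  show ?thesis
  proof
    assume ?E
    then obtain c where c: "\<And>q v w. q \<in> ?M \<Longrightarrow> v \<in> tangent_space ?M q \<Longrightarrow> w \<in> tangent_space ?M q \<Longrightarrow>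
      ricci ?M (stiefel_metric a0 a1) q v w = c * stiefel_metric a0 a1 q v w"
      unfolding E by blast
    obtain q :: "real^'p^'n" and H :: "real^'p^'n" and A :: "real^'p^'p"
      where q: "q \<in> stiefel" and H: "transpose q ** H = 0" "H \<noteq> 0" and A: "transpose A = - A" "A \<noteq> 0"
      by (rule stiefel_witness[OF card])
    have 0: "transpose q ** (0 :: real^'p^'n) = 0" "transpose (0 :: real^'p^'p) = - 0"
      by (simp_all add: matmul.zero_right transpose_zero)
    have T: "q ** 0 + H \<in> tangent_space ?M q" "q ** A + 0 \<in> tangent_space ?M q"
      unfolding tangent_space_stiefel[OF q] using q A H horizontal_cancel[OF H(1)]
      by (simp_all add: matrix_ring_simps stiefel_cancel stiefel_iff)
    have "?h * (H \<bullet> H) = c * (a0 * (H \<bullet> H))"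
      using c[OF q T(1) T(1)]
      unfolding ricci_stiefel[OF a \<alpha> q H(1) H(1) 0(2) 0(2)] stiefel_metric_split[OF q H(1) H(1)] by simp
    then have h: "?h = c * a0" using H(2) by simp
    have "?v * (A \<bullet> A) = c * (a1 * (A \<bullet> A))"
      using c[OF q T(2) T(2)]
      unfolding ricci_stiefel[OF a \<alpha> q 0(1) 0(1) A(1) A(1)] stiefel_metric_split[OF q 0(1) 0(1)] by simp
    then have "?v = c * a1" using A(2) by simp
    then show ?eq unfolding eq h a1 by simp
  next
    assume ?eq
    then have v: "?v = ?h / a0 * a1" and h: "?h = ?h / a0 * a0" using eq a a1 by simp_all
    have "ricci ?M (stiefel_metric a0 a1) q x y = (?h / a0) * stiefel_metric a0 a1 q x y"
      if q: "q \<in> ?M" and x: "x \<in> tangent_space ?M q" and y: "y \<in> tangent_space ?M q" for q x y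
    proof -
      obtain A H where A: "x = q ** A + H" "transpose q ** H = 0" "transpose A = - A"
        by (rule tangent_decompose[OF q x])
      obtain B K where B: "y = q ** B + K" "transpose q ** K = 0" "transpose B = - B"
        by (rule tangent_decompose[OF q y])
      have "ricci ?M (stiefel_metric a0 a1) q x y = ?h * (H \<bullet> K) + ?v * (A \<bullet> B)"
        unfolding A(1) B(1) by (rule ricci_stiefel[OF a \<alpha> q A(2) B(2) A(3) B(3)])
      also have "\<dots> = (?h / a0 * a0) * (H \<bullet> K) + (?h / a0 * a1) * (A \<bullet> B)"
        by (simp only: v flip: h)
      also have "\<dots> = (?h / a0) * stiefel_metric a0 a1 q x y"
        unfolding A(1) B(1) stiefel_metric_split[OF q A(2) B(2)] by (simp only: distrib_left mult.assoc)
      finally show ?thesis .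
    qed
    then show ?E unfolding E by blast
  qed
qed

theorem corollary1:
  assumes "1 < CARD('p::finite)" and "CARD('p) < CARD('n::finite)"
  defines "n \<equiv> real CARD('n)" and "p \<equiv> real CARD('p)"
  shows
    "(\<forall>\<alpha>0>0. \<forall>\<alpha>1>0. \<forall>\<alpha>. \<alpha> = \<alpha>1 / \<alpha>0 \<longrightarrow>
        (einstein_manifold (stiefel :: (real^'p^'n) set) (stiefel_metric \<alpha>0 \<alpha>1)
          \<longleftrightarrow> (n - 1) * \<alpha>^2 - (n - 2) * \<alpha> + (p - 2) / 4 = 0)) \<and>
     (CARD('p) = 2 \<longrightarrow>
        {\<alpha>. \<alpha> > 0 \<and> (\<exists>\<alpha>0>0. \<exists>\<alpha>1>0. \<alpha> = \<alpha>1 / \<alpha>0 \<and>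
               einstein_manifold (stiefel :: (real^'p^'n) set) (stiefel_metric \<alpha>0 \<alpha>1))}
        = {(n - 2) / (n - 1)}) \<and>
     (CARD('p) > 2 \<longrightarrow>
        card {\<alpha>. \<alpha> > 0 \<and> (\<exists>\<alpha>0>0. \<exists>\<alpha>1>0. \<alpha> = \<alpha>1 / \<alpha>0 \<and>
               einstein_manifold (stiefel :: (real^'p^'n) set) (stiefel_metric \<alpha>0 \<alpha>1))}
        = 2)"
proof -
  let ?E = "\<lambda>a0 a1. einstein_manifold (stiefel :: (real^'p^'n) set) (stiefel_metric a0 a1)"
  let ?f = "\<lambda>\<alpha>. (n - 1) * \<alpha>^2 - (n - 2) * \<alpha> + (p - 2) / 4"
  have iff: "?E \<alpha>0 \<alpha>1 \<longleftrightarrow> ?f \<alpha> = 0" if "\<alpha>0 > 0" "\<alpha>1 > 0" "\<alpha> = \<alpha>1 / \<alpha>0" for \<alpha>0 \<alpha>1 \<alpha>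
    unfolding n_def p_def by (rule einstein_stiefel_iff[OF assms(1,2) that])
  have set: "{\<alpha>. \<alpha> > 0 \<and> (\<exists>\<alpha>0>0. \<exists>\<alpha>1>0. \<alpha> = \<alpha>1 / \<alpha>0 \<and> ?E \<alpha>0 \<alpha>1)} = {\<alpha>. \<alpha> > 0 \<and> ?f \<alpha> = 0}"
  proof (intro Collect_cong conj_cong refl iffI)
    fix \<alpha> :: real assume "\<alpha> > 0"
    show "?f \<alpha> = 0" if "\<exists>\<alpha>0>0. \<exists>\<alpha>1>0. \<alpha> = \<alpha>1 / \<alpha>0 \<and> ?E \<alpha>0 \<alpha>1"
      using that iff by blast
    \<comment> \<open>Any positive ratio is attained with \<open>\<alpha>0 = 1\<close> and
      \<open>\<alpha>1 = \<alpha>\<close>.\<close>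
    show "\<exists>\<alpha>0>0. \<exists>\<alpha>1>0. \<alpha> = \<alpha>1 / \<alpha>0 \<and> ?E \<alpha>0 \<alpha>1" if "?f \<alpha> = 0"
      using iff[of 1 \<alpha> \<alpha>] that \<open>\<alpha> > 0\<close> by (intro exI[of _ 1] exI[of _ \<alpha>]) simp
  qed
  have np: "p \<ge> 2" "n \<ge> p + 1" using assms(1,2) unfolding n_def p_def by auto
  have two: "{\<alpha>. \<alpha> > 0 \<and> ?f \<alpha> = 0} = {(n - 2) / (n - 1)}" if "p = 2"
  proof -
    \<comment> \<open>For \<open>p = 2\<close> the constant term vanishes. Positivity excludes the
      root zero, and the other root is positive because \<open>n\<close> is at least 3.\<close>
    have "?f \<alpha> = \<alpha> * ((n - 1) * \<alpha> - (n - 2))" for \<alpha>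
      using that by (simp add: algebra_simps power2_eq_square)
    then have "?f \<alpha> = 0 \<longleftrightarrow> \<alpha> = 0 \<or> (n - 1) * \<alpha> = n - 2" for \<alpha>
      by simp
    then have "{\<alpha>. \<alpha> > 0 \<and> ?f \<alpha> = 0} = {\<alpha>. \<alpha> > 0 \<and> (n - 1) * \<alpha> = n - 2}"
      by auto
    also have "\<dots> = {(n - 2) / (n - 1)}"
      using np by (auto simp: field_simps)
    finally show ?thesis .
  qed
  have more: "card {\<alpha>. \<alpha> > 0 \<and> ?f \<alpha> = 0} = 2" if "p > 2"
  proof -
    define D where "D = (n - 2)\<^sup>2 - (n - 1) * (p - 2)"
    define s where "s = sqrt D"
    \<comment> \<open>The bound \<open>(n - 1) * (n - 3)\<close> is one less than the square of
      \<open>n - 2\<close>.\<close>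
    have "(n - 1) * (p - 2) \<le> (n - 1) * (n - 3)" using np by (intro mult_left_mono) auto
    then have "D > 0" unfolding D_def by (simp add: algebra_simps power2_eq_square)
    then have s: "s > 0" "s\<^sup>2 = D" by (simp_all add: s_def)
    \<comment> \<open>For \<open>p > 2\<close> the product subtracted in \<open>D\<close> is
      positive, so \<open>s < n - 2\<close>; this keeps the smaller root positive.\<close>
    have "s\<^sup>2 < (n - 2)\<^sup>2" unfolding s(2) D_def using np that by simp
    then have lt: "s < n - 2" using np by (simp add: power2_less_imp_less)
    define r where "r = (\<lambda>\<epsilon>. (n - 2 + \<epsilon> * s) / (2 * (n - 1)))"
    have r: "2 * (n - 1) * r \<epsilon> = n - 2 + \<epsilon> * s" for \<epsilon>
      using np by (simp add: r_def)
    have fac: "?f \<alpha> = (n - 1) * ((\<alpha> - r 1) * (\<alpha> - r (-1)))" for \<alpha>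
    proof -
      have "4 * (n - 1) * ?f \<alpha> = (2 * (n - 1) * \<alpha> - (n - 2))\<^sup>2 - D"
        unfolding D_def by (simp add: field_simps power2_eq_square)
      also have "\<dots> = (2 * (n - 1) * \<alpha> - (n - 2) - s) * (2 * (n - 1) * \<alpha> - (n - 2) + s)"
        unfolding s(2)[symmetric] by (simp add: algebra_simps power2_eq_square)
      also have "2 * (n - 1) * \<alpha> - (n - 2) - s = 2 * (n - 1) * (\<alpha> - r 1)"
        unfolding right_diff_distrib[of "2 * (n - 1)" \<alpha>] r by simp
      also have "2 * (n - 1) * \<alpha> - (n - 2) + s = 2 * (n - 1) * (\<alpha> - r (-1))"
        unfolding right_diff_distrib[of "2 * (n - 1)" \<alpha>] r by simp
      finally have "(4 * (n - 1)) * ?f \<alpha> = (4 * (n - 1)) * ((n - 1) * ((\<alpha> - r 1) * (\<alpha> - r (-1))))"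
        by (simp only: ac_simps)
      then show ?thesis using np by simp
    qed
    have "r 1 > 0" "r (-1) > 0" "r 1 \<noteq> r (-1)"
      using np s lt by (auto simp: r_def field_simps)
    then have "{\<alpha>. \<alpha> > 0 \<and> ?f \<alpha> = 0} = {r 1, r (-1)}"
      unfolding fac using np by auto
    then show ?thesis using \<open>r 1 \<noteq> r (-1)\<close> by simp
  qed
  have "p = 2" if "CARD('p) = 2" using that by (simp add: p_def)
  moreover have "p > 2" if "CARD('p) > 2" using that by (simp add: p_def)
  ultimately show ?thesis
    unfolding set using iff two more by (intro conjI allI impI) blast+
qed



end
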